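(* Let $n\ge 1$ and $r\geq 2$ be integers, let $p_1,\ldots,p_r>0$ with $\sum_{j=1}^r p_j=1$, put $p_*:=\min_{1\le j\le r}p_j$, and let $(U_1,\ldots,U_r)$ be the multinomial vector of observed counts of $n$ independent trials with classification probabilities $p_1,\ldots,p_r$. Let $\lambda>-1$ and let $T_\lambda$ be the power divergence statistic with index parameter $\lambda$. Suppose that $np_*\geq 2$. If $\lambda\geq 2$, suppose also that $np_*\geq 2(\lambda-2)^2$. Then: (a) For every $h\in C_b^2(\mathbb{R}^+)$, $$|\mathbb{E}[h(T_\lambda)]-\chi^2_{(r-1)}h|\leq \bigg(\frac{24}{r+1}\{3\|h\|+23\|h'\|+42\|h''\|\}+\frac{|\lambda-1|(4\lambda+7)}{\lambda+1}\|h'\|\bigg)\sum_{j=1}^r\frac{1}{\sqrt{np_j}}.$$ (b) For every $h\in C_b^{1,2}(\mathbb{R}^+)$, $$|\mathbb{E}[h(T_\lambda)]-\chi^2_{(r-1)}h|\leq \bigg(\frac{1}{\sqrt{r+1}}\{115\|h'\|+536\|h''\|\}+\frac{|\lambda-1|(4\lambda+7)}{\lambda+1}\|h'\|\bigg)\sum_{j=1}^r\frac{1}{\sqrt{np_j}}.$$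
   Context: $\mathbb{R}^+=[0,\infty)$. $C_b^k(\mathbb{R}^+)$ is the class of bounded functions $h:\mathbb{R}^+\to\mathbb{R}$ for which $h^{(k)}$ exists and the derivatives up to $k$-th order are bounded. For $j\le k$, $C_b^{j,k}(\mathbb{R}^+)$ is the class of functions $h:\mathbb{R}^+\to\mathbb{R}$ for which $h^{(k)}$ exists and the derivatives of order $j,j+1,\ldots,k$ are bounded. $\|\cdot\|$ is the supremum norm on $\mathbb{R}^+$. $\chi^2_{(r-1)}h:=\mathbb{E}[h(Y_{r-1})]$, where $Y_{r-1}$ has the chi-square distribution with $r-1$ degrees of freedom. The power divergence statistic, for $\lambda>-1$, $\lambda\ne 0$, is $$T_\lambda=\frac{2}{\lambda(\lambda+1)}\sum_{j=1}^rU_j\bigg[\bigg(\frac{U_j}{np_j}\bigg)^\lambda-1\bigg],$$ where $U_j(U_j/(np_j))^\lambda$ means $U_j^{\lambda+1}/(np_j)^\lambda$ (so it equals $0$ when $U_j=0$). For $\lambda=0$ it is defined by passage to the limit: $$T_0=2\sum_{j=1}^rU_j\log\bigg(\frac{U_j}{np_j}\bigg),\qquad 0\log 0:=0.$$ *)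

theory Defs
  imports "HOL-Probability.Probability"
begin

text \<open>
  Functions on \<open>\<real>\<^sup>+ = [0,\<infinity>)\<close> are represented by functions of type \<^typ>\<open>real \<Rightarrow> real\<close> of which
  only the values on \<open>{0..}\<close> matter. Derivatives are taken within \<open>{0..}\<close>, hence are
  one-sided at \<open>0\<close>.
\<close>

definition halfline_deriv :: "nat \<Rightarrow> (real \<Rightarrow> real) \<Rightarrow> real \<Rightarrow> real" where
  "halfline_deriv k h = ((\<lambda>g x. vector_derivative g (at x within {0..})) ^^ k) h"

text \<open>The highest derivative is required to exist and be bounded, but not to be continuous.\<close>

definition Cb_from_to :: "nat \<Rightarrow> nat \<Rightarrow> (real \<Rightarrow> real) set" where
  "Cb_from_to j k =
     {h. (\<forall>i<k. halfline_deriv i h differentiable_on {0..}) \<and>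
         (\<forall>i\<in>{j..k}. bounded (halfline_deriv i h ` {0..}))}"

definition Cb :: "nat \<Rightarrow> (real \<Rightarrow> real) set" where
  "Cb k = Cb_from_to 0 k"

definition halfline_norm :: "(real \<Rightarrow> real) \<Rightarrow> real" where
  "halfline_norm g = (SUP x\<in>{0..}. \<bar>g x\<bar>)"

definition chi_square_density :: "nat \<Rightarrow> real \<Rightarrow> real" where
  "chi_square_density k x =
     (if x < 0 then 0
      else x powr (real k / 2 - 1) * exp (- x / 2) / (2 powr (real k / 2) * Gamma (real k / 2)))"

definition chi_square :: "nat \<Rightarrow> real measure" where
  "chi_square k = density lborel (\<lambda>x. ennreal (chi_square_density k x))"

text \<open>
  The integral is restricted to \<open>{0..}\<close>, which carries the whole mass, because \<open>h\<close> may
  fail to be measurable on the negative half-line, where its values are irrelevant.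
\<close>

definition chi_square_expectation :: "nat \<Rightarrow> (real \<Rightarrow> real) \<Rightarrow> real" where
  "chi_square_expectation k h = (LINT x:{0..}|chi_square k. h x)"

text \<open>
  \<open>X i \<omega>\<close> is the class of the \<open>i\<close>-th trial; if the trials are independent and each falls
  into class \<open>j\<close> with probability \<open>p j\<close>, the vector of counts is multinomial.
\<close>

definition class_count :: "nat \<Rightarrow> (nat \<Rightarrow> 'a \<Rightarrow> nat) \<Rightarrow> 'a \<Rightarrow> nat \<Rightarrow> nat" where
  "class_count n X \<omega> j = card {i \<in> {1..n}. X i \<omega> = j}"

text \<open>
  The summands with \<open>u j = 0\<close> vanish, as \<open>u j\<close> is a factor and \<open>powr\<close> and \<open>ln\<close> are total;
  this is the convention that \<open>u j * (u j / (n * p j)) powr l\<close> stands for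
  \<open>u j powr (l + 1) / (n * p j) powr l\<close> and that \<open>0 * ln 0 = 0\<close>.
\<close>

definition power_divergence ::
  "real \<Rightarrow> nat \<Rightarrow> nat \<Rightarrow> (nat \<Rightarrow> real) \<Rightarrow> (nat \<Rightarrow> nat) \<Rightarrow> real" where
  "power_divergence l n r p u =
     (if l = 0 then 2 * (\<Sum>j=1..r. real (u j) * ln (real (u j) / (real n * p j)))
      else 2 / (l * (l + 1)) *
             (\<Sum>j=1..r. real (u j) * ((real (u j) / (real n * p j)) powr l - 1)))"

end

theory Submission
  imports Defs "HOL-Real_Asymp.Real_Asymp"
begin

text \<open>
  Pearson's statistic \<open>W\<close> (the case \<open>l = 1\<close>) is handled by Stein's method. Put \<open>k = r - 1\<close> and
  \<open>m = k + 2\<close>, and let \<open>g\<close> solve \<open>x g' + (k - x) g / 2 = h - c\<close>, where \<open>c\<close> is the chi-square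
  expectation of \<open>h\<close>. Differentiating, \<open>g'\<close> and \<open>g''\<close> solve equations of the same type with
  \<open>m\<close> and \<open>m + 2\<close> degrees of freedom and right-hand sides \<open>h' + g / 2\<close> and \<open>h'' + g'\<close>. For
  any such equation \<open>x v' + (m - x) v / 2 = u\<close>, comparison with the weight \<open>x\<^sup>m\<^sup>/\<^sup>2 e\<^sup>-\<^sup>x\<^sup>/\<^sup>2\<close>
  gives \<open>\<bar>(m - x) v / 2\<bar> \<le> sup \<bar>u\<bar>\<close>, hence \<open>\<bar>x v'\<bar> \<le> 2 sup \<bar>u\<bar>\<close>. Adding these two kinds of
  estimates for the same function cancels \<open>x\<close> and yields bounds of order \<open>1 / m\<close> on \<open>g'\<close> and \<open>g''\<close>.

  With \<open>G x = k g x / 2 + x g' x\<close> the error is the expectation of \<open>G W - W g W / 2\<close>. Size biasing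
  removes one trial; if \<open>w\<close> is the statistic of the remaining trials, expanding \<open>g\<close> to first order
  at \<open>w\<close> produces exactly \<open>G w\<close>, and the remainders are controlled by the first
  three absolute moments of the standardized counts.

  For general \<open>l\<close>, the statistic is a sum of terms \<open>n p\<^sub>j \<phi>(U\<^sub>j / (n p\<^sub>j))\<close> with
  \<open>\<phi> x = (x - 1)\<^sup>2 + O(\<bar>x - 1\<bar>\<^sup>3)\<close>, so its distance to \<open>W\<close> is governed by third absolute moments;
  for \<open>l > 2\<close> the error carries a factor \<open>x powr (l - 2)\<close>, whose moments are bounded by a
  Chernoff argument.
\<close>

section \<open>Multinomial expectations\<close>

text \<open>Expectation of \<open>\<phi>\<close> at the multinomial count vector, computed by
  conditioning on the class of one trial. This encoding turns moment computations into inductions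
  over finite sums, without integrability conditions.\<close>

primrec multinomial_exp ::
  "(nat \<Rightarrow> real) \<Rightarrow> nat \<Rightarrow> nat \<Rightarrow> ((nat \<Rightarrow> nat) \<Rightarrow> real) \<Rightarrow> real" where
  "multinomial_exp p r 0 \<phi> = \<phi> (\<lambda>_. 0)"
| "multinomial_exp p r (Suc n) \<phi> =
     (\<Sum>k=1..r. p k * multinomial_exp p r n (\<lambda>v. \<phi> (v(k := Suc (v k)))))"

locale class_probabilities =
  fixes r :: nat and p :: "nat \<Rightarrow> real"
  assumes p_pos: "j \<in> {1..r} \<Longrightarrow> 0 < p j" and sum_p: "(\<Sum>j=1..r. p j) = 1"
begin

abbreviation E :: "nat \<Rightarrow> ((nat \<Rightarrow> nat) \<Rightarrow> real) \<Rightarrow> real" where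
  "E \<equiv> multinomial_exp p r"

lemma p_le_1: "j \<in> {1..r} \<Longrightarrow> p j \<le> 1"
  using member_le_sum[of j "{1..r}" p] p_pos sum_p by (force simp: less_imp_le)

lemma r_pos: "1 \<le> r"
  using sum_p by (cases r) auto

text \<open>The count vectors reached by the recursion vanish off \<open>{1..r}\<close> and have
  total \<open>n\<close>; adding a trial preserves both. These facts are made available because the
  identities for the statistics rely on the total.\<close>

lemma E_mono:
  assumes "\<And>v. (\<forall>j. j \<notin> {1..r} \<longrightarrow> v j = 0) \<Longrightarrow> (\<Sum>j=1..r. v j) = n \<Longrightarrow> \<phi> v \<le> \<psi> v"
  shows "E n \<phi> \<le> E n \<psi>"
  using assms
proof (induction n arbitrary: \<phi> \<psi>)
  case (Suc n)
  have "E n (\<lambda>v. \<phi> (v(k := Suc (v k)))) \<le> E n (\<lambda>v. \<psi> (v(k := Suc (v k))))"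
    if k: "k \<in> {1..r}" for k
  proof (rule Suc.IH)
    fix v :: "nat \<Rightarrow> nat"
    assume v: "\<forall>j. j \<notin> {1..r} \<longrightarrow> v j = 0" "(\<Sum>j=1..r. v j) = n"
    have "(\<Sum>j=1..r. (v(k := Suc (v k))) j) = (\<Sum>j=1..r. v j + of_bool (j = k))"
      by (intro sum.cong) auto
    also have "\<dots> = Suc n"
      using k v(2) by (simp add: sum.distrib)
    finally show "\<phi> (v(k := Suc (v k))) \<le> \<psi> (v(k := Suc (v k)))"
      using v k by (intro Suc.prems) auto
  qed
  then show ?case
    unfolding multinomial_exp.simps by (intro sum_mono mult_left_mono) (use p_pos in \<open>auto intro: less_imp_le\<close>)
qed simp

lemma E_cong:
  assumes "\<And>v. (\<forall>j. j \<notin> {1..r} \<longrightarrow> v j = 0) \<Longrightarrow> (\<Sum>j=1..r. v j) = n \<Longrightarrow> \<phi> v = \<psi> v"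
  shows "E n \<phi> = E n \<psi>"
  by (intro antisym E_mono) (auto simp: assms)

lemma E_add: "E n (\<lambda>v. \<phi> v + \<psi> v) = E n \<phi> + E n \<psi>"
  by (induction n arbitrary: \<phi> \<psi>) (simp_all add: sum.distrib distrib_left)

lemma E_cmult: "E n (\<lambda>v. c * \<phi> v) = c * E n \<phi>"
  by (induction n arbitrary: \<phi>) (simp_all add: sum_distrib_left mult_ac)

lemma E_const: "E n (\<lambda>v. c) = c"
  using sum_p by (induction n) (simp_all flip: sum_distrib_right)

lemma E_diff: "E n (\<lambda>v. \<phi> v - \<psi> v) = E n \<phi> - E n \<psi>"
  using E_add[of n \<phi> "\<lambda>v. -1 * \<psi> v"] E_cmult[of n "-1" \<psi>] by simp

lemma E_sum: "finite A \<Longrightarrow> E n (\<lambda>v. \<Sum>i\<in>A. \<phi> i v) = (\<Sum>i\<in>A. E n (\<phi> i))"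
  by (induction A rule: finite_induct) (simp_all add: E_const E_add)

lemma abs_E_le: "\<bar>E n \<phi>\<bar> \<le> E n (\<lambda>v. \<bar>\<phi> v\<bar>)"
proof -
  have "E n \<phi> \<le> E n (\<lambda>v. \<bar>\<phi> v\<bar>)" "E n (\<lambda>v. - \<bar>\<phi> v\<bar>) \<le> E n \<phi>"
    by (rule E_mono, simp)+
  then show ?thesis
    using E_cmult[of n "-1" "\<lambda>v. \<bar>\<phi> v\<bar>"] by simp
qed

text \<open>\<open>u k\<close> is a sum of indicators, one per trial. By exchangeability each of the
  \<open>n + 1\<close> trials contributes \<open>p k\<close> times the expectation with that trial
  placed in class \<open>k\<close>. The induction splits off one trial, whose own indicator gives
  the extra summand.\<close>

lemma E_size_bias:
  assumes k: "k \<in> {1..r}"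
  shows "E (Suc n) (\<lambda>u. real (u k) * \<phi> u) = real (Suc n) * p k * E n (\<lambda>v. \<phi> (v(k := Suc (v k))))"
proof (induction n arbitrary: \<phi>)
  case 0
  have "E (Suc 0) (\<lambda>u. real (u k) * \<phi> u) = (\<Sum>j=1..r. if j = k then p k * \<phi> ((\<lambda>_. 0)(k := Suc 0)) else 0)"
    by (auto intro!: sum.cong simp del: sum.delta sum.delta')
  then show ?case
    using k by (simp del: multinomial_exp.simps(2) add: fun_upd_def)
next
  case (Suc n)
  have "E (Suc (Suc n)) (\<lambda>u. real (u k) * \<phi> u)
      = (\<Sum>j=1..r. p j * E (Suc n) (\<lambda>v. real (v k) * \<phi> (v(j := Suc (v j)))
          + of_bool (j = k) * \<phi> (v(j := Suc (v j)))))"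
    by (subst multinomial_exp.simps(2), intro sum.cong refl arg_cong2[where f = "(*)"] arg_cong2[where f = E] ext)
       (auto simp: algebra_simps)
  also have "\<dots> = (\<Sum>j=1..r. p j * E (Suc n) (\<lambda>v. real (v k) * \<phi> (v(j := Suc (v j)))))
      + (\<Sum>j=1..r. if j = k then p k * E (Suc n) (\<lambda>v. \<phi> (v(k := Suc (v k)))) else 0)"
    unfolding E_add E_cmult distrib_left sum.distrib
    by (intro arg_cong2[where f = "(+)"] sum.cong) auto
  also have "\<dots> = (\<Sum>j=1..r. p j * (real (Suc n) * p k * E n (\<lambda>v. \<phi> ((v(k := Suc (v k)))(j := Suc ((v(k := Suc (v k))) j))))))
      + p k * E (Suc n) (\<lambda>v. \<phi> (v(k := Suc (v k))))"
    unfolding Suc.IH using k by simp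
  also have "(\<Sum>j=1..r. p j * (real (Suc n) * p k * E n (\<lambda>v. \<phi> ((v(k := Suc (v k)))(j := Suc ((v(k := Suc (v k))) j))))))
      = real (Suc n) * p k * E (Suc n) (\<lambda>v. \<phi> (v(k := Suc (v k))))"
    unfolding multinomial_exp.simps(2) sum_distrib_left
    by (intro sum.cong refl) (auto simp: mult_ac fun_upd_twist intro!: arg_cong[where f = "E n"] ext arg_cong[where f = \<phi>])
  finally show ?case
    by (simp add: algebra_simps del: multinomial_exp.simps(2) fun_upd_apply)
qed

section \<open>Moments of a single count\<close>

lemma E_marginal_Suc:
  assumes j: "j \<in> {1..r}"
  shows "E (Suc n) (\<lambda>u. \<psi> (u j)) = p j * E n (\<lambda>v. \<psi> (Suc (v j))) + (1 - p j) * E n (\<lambda>v. \<psi> (v j))"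
proof -
  have "(\<Sum>k\<in>{1..r}-{j}. p k) = 1 - p j"
    using j sum_p by (simp add: sum_diff1)
  moreover have "E (Suc n) (\<lambda>u. \<psi> (u j)) = p j * E n (\<lambda>v. \<psi> (Suc (v j)))
      + (\<Sum>k\<in>{1..r}-{j}. p k * E n (\<lambda>v. \<psi> (v j)))"
    unfolding multinomial_exp.simps sum.remove[OF finite_atLeastAtMost j]
    by (intro arg_cong2[where f = "(+)"] sum.cong) auto
  ultimately show ?thesis
    by (simp add: sum_distrib_right[symmetric])
qed

text \<open>The count is binomial, so its moment generating function is a power of
  \<open>1 + p j * (exp t - 1)\<close>; \<open>1 + x \<le> exp x\<close> then gives the Poisson
  bound.\<close>

lemma E_exp_le:
  assumes j: "j \<in> {1..r}"
  shows "E n (\<lambda>u. exp (t * real (u j))) \<le> exp (real n * p j * (exp t - 1))"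
proof -
  have "E n (\<lambda>u. exp (t * real (u j))) = (1 + p j * (exp t - 1)) ^ n"
  proof (induction n)
    case (Suc n)
    have "E (Suc n) (\<lambda>u. exp (t * real (u j)))
        = p j * E n (\<lambda>v. exp t * exp (t * real (v j))) + (1 - p j) * E n (\<lambda>v. exp (t * real (v j)))"
      unfolding E_marginal_Suc[OF j, of n "\<lambda>x. exp (t * real x)"]
      by (simp add: distrib_left exp_add mult_ac)
    also have "\<dots> = (1 + p j * (exp t - 1)) ^ Suc n"
      unfolding E_cmult Suc.IH by (simp add: algebra_simps)
    finally show ?case .
  qed simp
  also have "\<dots> \<le> exp (p j * (exp t - 1)) ^ n"
  proof (rule power_mono)
    \<comment> \<open>Monotonicity of the power needs a nonnegative base: for
      \<open>t \<le> 0\<close> both factors lie in \<open>[0, 1]\<close>, otherwise the product is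
      negative.\<close>
    have "p j * (1 - exp t) \<le> 1 * 1"
      using p_pos[OF j] p_le_1[OF j] by (cases "t \<le> 0", intro mult_mono) (auto simp: mult_le_0_iff intro: order_trans[of _ 0])
    then show "0 \<le> 1 + p j * (exp t - 1)"
      by (simp add: algebra_simps)
  qed simp
  finally show ?thesis
    by (simp add: exp_of_nat_mult[symmetric] mult_ac)
qed

text \<open>One more trial moves the centred count by \<open>1 - p j\<close> with probability
  \<open>p j\<close> and by \<open>- p j\<close> otherwise; expanding the powers gives recurrences
  in \<open>n\<close> that involve only moments of the same and lower order.\<close>

lemma E_central_moments:
  fixes n :: nat
  assumes j: "j \<in> {1..r}"
  defines "m \<equiv> \<lambda>i. E n (\<lambda>u. (real (u j) - real n * p j) ^ i)"
  shows "m 1 = 0" "m 2 = real n * (p j * (1 - p j))"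
    "m 4 \<le> 3 * real n ^ 2 * (p j * (1 - p j)) ^ 2 + real n * (p j * (1 - p j))"
proof -
  define M where "M = (\<lambda>n i. E n (\<lambda>u. (real (u j) - real n * p j) ^ i))"
  let ?P = "p j" and ?Q = "1 - p j"
  have step: "M (Suc n) i = E n (\<lambda>v. ?P * (real (v j) - real n * ?P + ?Q) ^ i + ?Q * (real (v j) - real n * ?P - ?P) ^ i)"
    for n i
    unfolding M_def E_marginal_Suc[OF j, of n "\<lambda>x. (real x - real (Suc n) * ?P) ^ i"] E_add E_cmult
    by (simp add: algebra_simps)
  have M1: "M n 1 = 0" for n
  proof (induction n)
    case (Suc n)
    have "M (Suc n) 1 = E n (\<lambda>v. (real (v j) - real n * ?P) ^ 1)"
      unfolding step by (intro arg_cong[where f = "E n"] ext) (simp add: algebra_simps)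
    then show ?case using Suc by (simp add: M_def)
  qed (simp add: M_def)
  have M2: "M n 2 = real n * (?P * ?Q)" for n
  proof (induction n)
    case (Suc n)
    have "M (Suc n) 2 = E n (\<lambda>v. (real (v j) - real n * ?P) ^ 2 + ?P * ?Q)"
      unfolding step by (intro arg_cong[where f = "E n"] ext) (simp add: algebra_simps power2_eq_square)
    also have "\<dots> = M n 2 + ?P * ?Q"
      unfolding E_add E_const M_def ..
    finally show ?case using Suc by (simp add: algebra_simps)
  qed (simp add: M_def)
  have PQ: "0 \<le> ?P * ?Q"
    using p_pos[OF j] p_le_1[OF j] by simp
  have M4: "M n 4 \<le> 3 * real n ^ 2 * (?P * ?Q) ^ 2 + real n * (?P * ?Q)" for n
  proof (induction n)
    case (Suc n)
    have "M (Suc n) 4 = E n (\<lambda>v. (real (v j) - real n * ?P) ^ 4 + (6 * (?P * ?Q) * (real (v j) - real n * ?P) ^ 2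
        + (4 * (?P * ?Q) * (?Q - ?P) * (real (v j) - real n * ?P) ^ 1 + ?P * ?Q * (1 - 3 * (?P * ?Q)))))"
      unfolding step by (intro arg_cong[where f = "E n"] ext) algebra
    also have "\<dots> = M n 4 + (6 * (?P * ?Q) * M n 2 + (4 * (?P * ?Q) * (?Q - ?P) * M n 1 + ?P * ?Q * (1 - 3 * (?P * ?Q))))"
      unfolding E_add E_cmult E_const M_def ..
    also have "\<dots> = M n 4 + 6 * real n * (?P * ?Q)^2 + ?P * ?Q - 3 * (?P * ?Q)^2"
      unfolding M1 M2 by (simp add: algebra_simps power2_eq_square)
    \<comment> \<open>The sign of the quadratic term is flipped so that \<open>3 * n\<^sup>2\<close>
      completes to \<open>3 * (n + 1)\<^sup>2\<close>.\<close>
    also have "\<dots> \<le> (3 * real n ^ 2 * (?P * ?Q) ^ 2 + real n * (?P * ?Q)) + 6 * real n * (?P * ?Q)^2 + ?P * ?Q + 3 * (?P * ?Q)^2"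
      using Suc zero_le_power2[of "?P * ?Q"] by linarith
    also have "\<dots> = 3 * real (Suc n) ^ 2 * (?P * ?Q) ^ 2 + real (Suc n) * (?P * ?Q)"
      by (simp add: algebra_simps power2_eq_square)
    finally show ?case .
  qed (simp add: M_def)
  show "m 1 = 0" "m 2 = real n * (p j * (1 - p j))"
    "m 4 \<le> 3 * real n ^ 2 * (p j * (1 - p j)) ^ 2 + real n * (p j * (1 - p j))"
    using M1 M2 M4 unfolding M_def m_def by blast+
qed

lemma E_standardized_moments:
  assumes j: "j \<in> {1..r}" and n': "n' \<le> n" and np: "2 \<le> real n * p j"
  defines "s \<equiv> \<lambda>u :: nat \<Rightarrow> nat. (real (u j) - real n' * p j) / sqrt (real n * p j)"
  shows "E n' (\<lambda>u. s u ^ 2) \<le> 1" "E n' (\<lambda>u. s u ^ 4) \<le> 7 / 2"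
    "E n' (\<lambda>u. \<bar>s u\<bar> ^ 3) \<le> 15 / 8" "E n' (\<lambda>u. \<bar>s u\<bar>) \<le> 1"
proof -
  let ?N = "real n * p j" and ?x = "real n' * (p j * (1 - p j))"
  have N: "0 < ?N" using np by simp
  have x: "0 \<le> ?x" "?x \<le> ?N"
  proof -
    show "0 \<le> ?x" using p_pos[OF j] p_le_1[OF j] by simp
    have "real n' * (p j * (1 - p j)) \<le> real n * (p j * 1)"
      using p_pos[OF j] p_le_1[OF j] n' by (intro mult_mono) auto
    then show "?x \<le> ?N" by simp
  qed
  have "(\<lambda>u. s u ^ 2) = (\<lambda>u. (1 / ?N) * (real (u j) - real n' * p j) ^ 2)"
    using N by (simp add: s_def power_divide real_sqrt_pow2 fun_eq_iff)
  then have "E n' (\<lambda>u. s u ^ 2) = ?x / ?N"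
    using E_central_moments(2)[OF j, of n'] by (simp only: E_cmult) (simp only: times_divide_eq_left mult_1)
  with x N show 2: "E n' (\<lambda>u. s u ^ 2) \<le> 1"
    by (simp only: divide_le_eq_1_pos)
  have sq4: "sqrt ?N ^ 4 = ?N ^ 2"
    using N by (metis less_imp_le mult_2_right numeral_Bit0 power_add power2_eq_square real_sqrt_pow2)
  have "(\<lambda>u. s u ^ 4) = (\<lambda>u. (1 / ?N ^ 2) * (real (u j) - real n' * p j) ^ 4)"
    using N sq4 by (simp add: s_def power_divide fun_eq_iff)
  then have "E n' (\<lambda>u. s u ^ 4) = (1 / ?N ^ 2) * E n' (\<lambda>u. (real (u j) - real n' * p j) ^ 4)"
    by (simp only: E_cmult)
  also have "\<dots> \<le> (1 / ?N ^ 2) * (3 * ?x ^ 2 + ?x)"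
    using E_central_moments(3)[OF j, of n'] N by (intro mult_left_mono) (auto simp: power_mult_distrib mult_ac)
  \<comment> \<open>The variance \<open>?x\<close> is at most \<open>?N\<close>, and
    \<open>2 \<le> ?N\<close> turns the linear term into \<open>?N\<^sup>2 / 2\<close>; this gives
    \<open>3 + 1/2\<close>.\<close>
  also have "\<dots> \<le> (1 / ?N ^ 2) * (3 * ?N ^ 2 + ?N * (?N / 2))"
  proof -
    have "?x * 1 \<le> ?N * (?N / 2)" using mult_mono[of ?x ?N 1 "?N / 2"] x np by auto
    moreover have "?x ^ 2 \<le> ?N ^ 2" using x by (intro power_mono)
    ultimately show ?thesis using N by (intro mult_left_mono) auto
  qed
  also have "\<dots> = 7 / 2"
  proof -
    have "(1 / y ^ 2) * (3 * y ^ 2 + y * (y / 2)) = 7 / 2" if "0 < y" for y :: real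
      using that by (simp add: field_simps power2_eq_square)
    then show ?thesis using N .
  qed
  finally show 4: "E n' (\<lambda>u. s u ^ 4) \<le> 7 / 2" .
  \<comment> \<open>Interpolation of the third moment between the second and the fourth:
    \<open>1 + 1/4 * 7/2 = 15/8\<close>.\<close>
  have "\<bar>y\<bar> ^ 3 \<le> y ^ 2 + (1/4) * y ^ 4" for y :: real
  proof -
    have "0 \<le> (\<bar>y\<bar> * (1 - \<bar>y\<bar> / 2)) ^ 2" by simp
    also have "\<dots> = \<bar>y\<bar> ^ 2 - \<bar>y\<bar> ^ 3 + (1/4) * \<bar>y\<bar> ^ 4" by algebra
    finally show ?thesis by simp
  qed
  then have "E n' (\<lambda>u. \<bar>s u\<bar> ^ 3) \<le> E n' (\<lambda>u. s u ^ 2 + (1/4) * s u ^ 4)"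
    by (intro E_mono) auto
  then show "E n' (\<lambda>u. \<bar>s u\<bar> ^ 3) \<le> 15 / 8"
    using 2 4 unfolding E_add E_cmult by simp
  have "\<bar>y\<bar> \<le> 1/2 + (1/2) * y ^ 2" for y :: real
    using zero_le_power2[of "\<bar>y\<bar> - 1"] by (simp add: power2_diff)
  then have "E n' (\<lambda>u. \<bar>s u\<bar>) \<le> E n' (\<lambda>u. 1/2 + (1/2) * s u ^ 2)"
    by (intro E_mono) auto
  then show "E n' (\<lambda>u. \<bar>s u\<bar>) \<le> 1"
    using 2 unfolding E_add E_cmult E_const by simp
qed

end

section \<open>The count vector of independent trials\<close>

lemma class_count_Suc:
  "class_count (Suc n) X \<omega> = (class_count n X \<omega>)(X (Suc n) \<omega> := Suc (class_count n X \<omega> (X (Suc n) \<omega>)))"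
proof
  fix j
  have "{i \<in> {1..Suc n}. X i \<omega> = j} = {i \<in> {1..n}. X i \<omega> = j} \<union> (if X (Suc n) \<omega> = j then {Suc n} else {})"
    by (auto simp: le_Suc_eq)
  then show "class_count (Suc n) X \<omega> j = ((class_count n X \<omega>)(X (Suc n) \<omega> := Suc (class_count n X \<omega> (X (Suc n) \<omega>)))) j"
    by (auto simp: class_count_def)
qed

text \<open>The class of the last trial is independent of the counts of the earlier ones, so
  splitting according to that class reproduces the recursion of
  \<open>multinomial_exp\<close>.\<close>

lemma (in prob_space) expectation_class_count:
  fixes X :: "nat \<Rightarrow> 'a \<Rightarrow> nat"
  assumes indep: "indep_vars (\<lambda>_. count_space {1..r}) X {1..n}"
    and distr: "\<And>i j. i \<in> {1..n} \<Longrightarrow> j \<in> {1..r} \<Longrightarrow> measure M {\<omega> \<in> space M. X i \<omega> = j} = p j"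
  shows "(LINT \<omega>|M. \<phi> (class_count n X \<omega>)) = multinomial_exp p r n \<phi>"
  using assms
proof (induction n arbitrary: \<phi>)
  case 0
  have "class_count 0 X \<omega> = (\<lambda>_. 0)" for \<omega>
    by (simp add: class_count_def fun_eq_iff)
  then show ?case by (simp add: prob_space)
next
  case (Suc n)
  let ?C = "count_space {1..r}"
  let ?A = "\<lambda>k. {\<omega> \<in> space M. X (Suc n) \<omega> = k}"
  have indep': "indep_vars (\<lambda>_. ?C) X {1..n}"
    by (rule indep_vars_subset[OF Suc.prems(1)]) auto
  have meas: "X (Suc n) \<in> measurable M ?C"
    using Suc.prems(1) by (auto simp: indep_vars_def)
  then have X: "X (Suc n) \<omega> \<in> {1..r}" if "\<omega> \<in> space M" for \<omega>
    using measurable_space[OF meas that] by simp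
  have split: "integrable M (\<lambda>\<omega>. indicator (?A k) \<omega> * \<psi> (class_count n X \<omega>)) \<and>
      (LINT \<omega>|M. indicator (?A k) \<omega> * \<psi> (class_count n X \<omega>)) = p k * multinomial_exp p r n \<psi>"
    if k: "k \<in> {1..r}" for k and \<psi> :: "(nat \<Rightarrow> nat) \<Rightarrow> real"
  proof -
    \<comment> \<open>The earlier counts are a function of the first \<open>n\<close> trials alone.
      \<open>?f\<close> and \<open>?g\<close> act on finite families of classes, whose product
      spaces are discrete, so both are measurable.\<close>
    let ?f = "\<lambda>x. \<psi> (\<lambda>j. card {i \<in> {1..n}. x i = j})"
    let ?g = "\<lambda>x. indicator {k} (x (Suc n)) :: real"
    let ?R = "\<lambda>A \<omega>. restrict (\<lambda>i. X i \<omega>) A"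
    have "indep_var (PiM {Suc n} (\<lambda>_. ?C)) (?R {Suc n}) (PiM {1..n} (\<lambda>_. ?C)) (?R {1..n})"
      by (rule indep_var_restrict[OF Suc.prems(1)]) auto
    then have "indep_var borel (?g \<circ> ?R {Suc n}) borel (?f \<circ> ?R {1..n})"
      by (rule indep_var_compose) (simp_all add: count_space_PiM_finite)
    moreover have "?f \<circ> ?R {1..n} = (\<lambda>\<omega>. \<psi> (class_count n X \<omega>))"
      by (auto simp: fun_eq_iff class_count_def intro!: arg_cong[where f = \<psi>] arg_cong[where f = card])
    moreover have "?g \<circ> ?R {Suc n} = (\<lambda>\<omega>. indicator {k} (X (Suc n) \<omega>))"
      by auto
    ultimately have iv: "indep_var borel (\<lambda>\<omega>. indicator {k} (X (Suc n) \<omega>) :: real) borel (\<lambda>\<omega>. \<psi> (class_count n X \<omega>))"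
      by simp
    have ind: "indicator {k} (X (Suc n) \<omega>) = (indicator (?A k) \<omega> :: real)" if "\<omega> \<in> space M" for \<omega>
      using that by (auto simp: indicator_def)
    have Ak: "?A k \<in> events"
      using measurable_sets[OF meas, of "{k}"] k by (simp add: vimage_def Int_def conj_commute)
    then have int1: "integrable M (\<lambda>\<omega>. indicator {k} (X (Suc n) \<omega>) :: real)"
      using ind by (subst Bochner_Integration.integrable_cong[OF refl ind]) (auto intro!: integrable_real_indicator simp: less_top[symmetric])
    \<comment> \<open>Only finitely many count vectors occur, so every function of the counts is
      bounded and hence integrable.\<close>
    have fin: "finite ((\<lambda>\<omega>. class_count n X \<omega>) ` space M)"
    proof (rule finite_subset)
      have "X i \<omega> \<in> {1..r}" if "\<omega> \<in> space M" "i \<in> {1..n}" for \<omega> i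
      proof -
        have "X i \<in> measurable M ?C"
          using indep' that(2) by (auto simp: indep_vars_def)
        from measurable_space[OF this that(1)] show ?thesis by simp
      qed
      then have "class_count n X \<omega> = (\<lambda>j. card {i \<in> {1..n}. ?R {1..n} \<omega> i = j}) \<and> ?R {1..n} \<omega> \<in> PiE {1..n} (\<lambda>_. {1..r})"
        if "\<omega> \<in> space M" for \<omega>
        using that by (auto simp: class_count_def fun_eq_iff intro!: arg_cong[where f = card])
      then show "(\<lambda>\<omega>. class_count n X \<omega>) ` space M
          \<subseteq> (\<lambda>x j. card {i \<in> {1..n}. x i = j}) ` PiE {1..n} (\<lambda>_. {1..r})"
        by blast
      show "finite ((\<lambda>x j. card {i \<in> {1..n}. x i = j}) ` PiE {1..n} (\<lambda>_. {1..r}))"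
        by (intro finite_imageI finite_PiE) auto
    qed
    have int2: "integrable M (\<lambda>\<omega>. \<psi> (class_count n X \<omega>))"
    proof (rule integrable_const_bound)
      show "AE \<omega> in M. norm (\<psi> (class_count n X \<omega>)) \<le> Max ((\<lambda>u. norm (\<psi> u)) ` (\<lambda>\<omega>. class_count n X \<omega>) ` space M)"
        using fin by (intro AE_I2 Max_ge) auto
      show "(\<lambda>\<omega>. \<psi> (class_count n X \<omega>)) \<in> borel_measurable M"
        by (rule indep_var_rv2[OF iv])
    qed
    have "(LINT \<omega>|M. indicator {k} (X (Suc n) \<omega>) * \<psi> (class_count n X \<omega>)) = p k * multinomial_exp p r n \<psi>"
    proof -
      have "(LINT \<omega>|M. indicator {k} (X (Suc n) \<omega>) :: real) = p k"
        using Suc.prems(2)[of "Suc n" k] k Ak by (subst Bochner_Integration.integral_cong[OF refl ind]) auto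
      moreover have "(LINT \<omega>|M. \<psi> (class_count n X \<omega>)) = multinomial_exp p r n \<psi>"
        by (rule Suc.IH[OF indep']) (use Suc.prems(2) in auto)
      ultimately show ?thesis
        using indep_var_lebesgue_integral[OF iv int1 int2] by simp
    qed
    moreover have "integrable M (\<lambda>\<omega>. indicator {k} (X (Suc n) \<omega>) * \<psi> (class_count n X \<omega>))"
      by (rule indep_var_integrable[OF iv int1 int2])
    ultimately show ?thesis
      using ind by (simp cong: Bochner_Integration.integral_cong Bochner_Integration.integrable_cong)
  qed
  have "(LINT \<omega>|M. \<phi> (class_count (Suc n) X \<omega>))
      = (LINT \<omega>|M. (\<Sum>k=1..r. indicator (?A k) \<omega> * \<phi> ((class_count n X \<omega>)(k := Suc (class_count n X \<omega> k)))))"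
  proof (rule Bochner_Integration.integral_cong[OF refl])
    fix \<omega> assume \<omega>: "\<omega> \<in> space M"
    have "(\<Sum>k=1..r. indicator (?A k) \<omega> * \<phi> ((class_count n X \<omega>)(k := Suc (class_count n X \<omega> k))))
        = (\<Sum>k=1..r. if k = X (Suc n) \<omega> then \<phi> ((class_count n X \<omega>)(k := Suc (class_count n X \<omega> k))) else 0)"
      using \<omega> by (intro sum.cong) (auto simp: indicator_def)
    also have "\<dots> = \<phi> (class_count (Suc n) X \<omega>)"
      using X[OF \<omega>] by (simp add: class_count_Suc)
    finally show "\<phi> (class_count (Suc n) X \<omega>)
        = (\<Sum>k=1..r. indicator (?A k) \<omega> * \<phi> ((class_count n X \<omega>)(k := Suc (class_count n X \<omega> k))))" ..
  qed
  also have "\<dots> = (\<Sum>k=1..r. LINT \<omega>|M. indicator (?A k) \<omega> * \<phi> ((class_count n X \<omega>)(k := Suc (class_count n X \<omega> k))))"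
    by (intro Bochner_Integration.integral_sum split[THEN conjunct1])
  also have "\<dots> = multinomial_exp p r (Suc n) \<phi>"
    unfolding multinomial_exp.simps by (intro sum.cong refl split[THEN conjunct2])
  finally show ?case .
qed

section \<open>The Stein equation of the chi-square distribution\<close>

text \<open>Up to a constant, \<open>x\<close> times the chi-square density with \<open>m\<close>
  degrees of freedom. It is the integrating factor of \<open>x v' + (m - x) v / 2 = u\<close>: the
  derivative of \<open>chi_weight m x * v x\<close> is
  \<open>chi_weight m x * u x / x\<close>.\<close>

definition chi_weight :: "real \<Rightarrow> real \<Rightarrow> real" where
  "chi_weight m x = x powr (m / 2) * exp (- x / 2)"

lemma chi_weight_pos: "0 < x \<Longrightarrow> 0 < chi_weight m x"
  by (simp add: chi_weight_def)

lemma chi_weight_add_2: "0 < x \<Longrightarrow> chi_weight (m + 2) x = x * chi_weight m x"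
  by (simp add: chi_weight_def add_divide_distrib powr_add)

lemma chi_weight_deriv:
  assumes "0 < x"
  shows "(chi_weight m has_real_derivative (m - x) / 2 * chi_weight m x / x) (at x)"
proof -
  have "((\<lambda>x. x powr (m / 2)) has_real_derivative m / 2 * x powr (m / 2 - 1)) (at x)"
    using assms by (rule has_real_derivative_powr)
  moreover have "((\<lambda>x. exp (- x / 2)) has_real_derivative exp (- x / 2) * (- 1 / 2)) (at x)"
    by (auto intro!: derivative_eq_intros)
  ultimately have "(chi_weight m has_real_derivative
      m / 2 * x powr (m / 2 - 1) * exp (- x / 2) + exp (- x / 2) * (- 1 / 2) * x powr (m / 2)) (at x)"
    unfolding chi_weight_def by (rule DERIV_mult)
  moreover have "x powr (m / 2 - 1) = x powr (m / 2) / x"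
    using assms by (simp add: powr_diff)
  moreover have "m / 2 * (P / x) * e + e * (- 1 / 2) * P = (m - x) / 2 * (P * e) / x" for P e :: real
    using assms by (simp add: field_simps)
  ultimately show ?thesis
    by (simp only: chi_weight_def)
qed

lemma chi_weight_affine_lim:
  assumes "0 < m" "\<And>x. 0 < x \<Longrightarrow> \<bar>w x\<bar> \<le> A + B * x"
  shows "((\<lambda>x. chi_weight m x * w x) \<longlongrightarrow> 0) (at_right 0)"
    and "((\<lambda>x. chi_weight m x * w x) \<longlongrightarrow> 0) at_top"
proof -
  have bd: "\<bar>chi_weight m x * w x\<bar> \<le> chi_weight m x * (A + B * x)" if "0 < x" for x
    using assms(2)[OF that] chi_weight_pos[OF that, of m] by (auto simp: abs_mult intro!: mult_left_mono)
  have "((\<lambda>x. chi_weight m x * (A + B * x)) \<longlongrightarrow> 0) (at_right 0)"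
  proof -
    have "(chi_weight m \<longlongrightarrow> 0) (at_right 0)"
      unfolding chi_weight_def using assms(1) by real_asymp
    moreover have "((\<lambda>x. A + B * x) \<longlongrightarrow> A + B * 0) (at_right 0)"
      by (intro tendsto_intros)
    ultimately show ?thesis using tendsto_mult by fastforce
  qed
  then show "((\<lambda>x. chi_weight m x * w x) \<longlongrightarrow> 0) (at_right 0)"
    by (rule Lim_null_comparison[rotated])
       (auto simp: eventually_at_filter intro!: always_eventually bd)
  have "((\<lambda>x. chi_weight m x * (A + B * x)) \<longlongrightarrow> 0) at_top"
  proof -
    have "(chi_weight m \<longlongrightarrow> 0) at_top" "((\<lambda>x. chi_weight m x * x) \<longlongrightarrow> 0) at_top"
      unfolding chi_weight_def using assms(1) by real_asymp+
    then have "((\<lambda>x. chi_weight m x * A + B * (chi_weight m x * x)) \<longlongrightarrow> 0 * A + B * 0) at_top"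
      by (intro tendsto_intros)
    then show ?thesis by (simp add: algebra_simps)
  qed
  then show "((\<lambda>x. chi_weight m x * w x) \<longlongrightarrow> 0) at_top"
    by (rule Lim_null_comparison[rotated])
       (auto simp: eventually_at_top_dense intro!: exI[of _ 0] bd)
qed

section \<open>Comparison arguments for the first-order equation\<close>

lemma nonpos_if_antimono_from_0:
  fixes K :: "real \<Rightarrow> real"
  assumes x: "0 < x" and lim: "(K \<longlongrightarrow> 0) (at_right 0)"
    and deriv: "\<And>t. 0 < t \<Longrightarrow> t \<le> x \<Longrightarrow> (K has_real_derivative K' t) (at t) \<and> K' t \<le> 0"
  shows "K x \<le> 0"
proof (rule tendsto_lowerbound[OF lim])
  have "K x \<le> K e" if "0 < e" "e < x" for e
  proof (rule DERIV_nonpos_imp_nonincreasing[of e x K])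
    show "\<exists>y. (K has_real_derivative y) (at t) \<and> y \<le> 0" if "e \<le> t" "t \<le> x" for t
      using deriv[of t] that \<open>0 < e\<close> by auto
  qed (use that in simp)
  then show "\<forall>\<^sub>F e in at_right 0. K x \<le> K e"
    using x by (auto simp: eventually_at_right_field)
qed simp

lemma nonpos_if_mono_to_infinity:
  fixes K :: "real \<Rightarrow> real"
  assumes lim: "(K \<longlongrightarrow> 0) at_top"
    and deriv: "\<And>t. x \<le> t \<Longrightarrow> (K has_real_derivative K' t) (at t) \<and> 0 \<le> K' t"
  shows "K x \<le> 0"
proof (rule tendsto_lowerbound[OF lim])
  have "K x \<le> K e" if "x < e" for e
  proof (rule DERIV_nonneg_imp_nondecreasing[of x e K])
    show "\<exists>y. (K has_real_derivative y) (at t) \<and> 0 \<le> y" if "x \<le> t" "t \<le> e" for t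
      using deriv[of t] that by auto
  qed (use that in simp)
  then show "\<forall>\<^sub>F e in at_top. K x \<le> K e"
    by (auto simp: eventually_at_top_dense)
qed simp

text \<open>The two limits single out the bounded solution and force \<open>u\<close> to be centred for the
  chi-square distribution with \<open>m\<close> degrees of freedom.\<close>

locale chi_ode =
  fixes m :: real and v u :: "real \<Rightarrow> real"
  assumes m_pos: "0 < m"
    and ode: "0 < x \<Longrightarrow> (v has_real_derivative (u x - (m - x) / 2 * v x) / x) (at x)"
    and lim_0: "((\<lambda>x. chi_weight m x * v x) \<longlongrightarrow> 0) (at_right 0)"
    and lim_top: "((\<lambda>x. chi_weight m x * v x) \<longlongrightarrow> 0) at_top"
begin

lemma weighted_deriv:
  assumes "0 < x"
  shows "((\<lambda>x. chi_weight m x * v x) has_real_derivative chi_weight m x * u x / x) (at x)"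
  by (rule DERIV_cong[OF DERIV_mult[OF chi_weight_deriv[OF assms] ode[OF assms]]])
     (use assms in \<open>simp add: field_simps\<close>)

lemma drift_bound:
  assumes bound: "\<And>x. 0 < x \<Longrightarrow> \<bar>u x\<bar> \<le> B" and x: "0 < x"
  shows "\<bar>(m - x) / 2 * v x\<bar> \<le> B"
proof -
  have "s * \<bar>m - x\<bar> / 2 * v x \<le> B" if s: "\<bar>s\<bar> = 1" for s
  proof -
    let ?d = "\<bar>m - x\<bar> / 2"
    \<comment> \<open>The factor \<open>?d\<close> is frozen at the point \<open>x\<close>. On the
      side of \<open>x\<close> away from \<open>m\<close>, \<open>?d\<close> is at most
      \<open>\<bar>m - t\<bar> / 2\<close>, so the derivative of \<open>?J\<close> has a fixed sign
      there, and \<open>?J\<close> tends to zero at the far end of that side.\<close>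
    let ?J = "\<lambda>t. s * ?d * (chi_weight m t * v t) - B * chi_weight m t"
    let ?J' = "\<lambda>t. chi_weight m t / t * (s * u t * ?d - B * ((m - t) / 2))"
    have deriv: "(?J has_real_derivative ?J' t) (at t)" if "0 < t" for t
      by (rule DERIV_cong[OF DERIV_diff[OF DERIV_cmult[OF weighted_deriv[OF that]] DERIV_cmult[OF chi_weight_deriv[OF that]]]])
         (use that in \<open>simp add: field_simps\<close>)
    have lims: "(?J \<longlongrightarrow> s * ?d * 0 - B * 0) (at_right 0)" "(?J \<longlongrightarrow> s * ?d * 0 - B * 0) at_top"
      using chi_weight_affine_lim[OF m_pos, of "\<lambda>_. 1" 1 0] lim_0 lim_top
      by (intro tendsto_intros; simp)+
    have su: "\<bar>s * u t * ?d\<bar> \<le> B * ?d" if "0 < t" for t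
      using bound[OF that] s by (auto simp: abs_mult intro!: mult_right_mono)
    have B: "0 \<le> B" using bound[of 1] by simp
    have "?J x \<le> 0"
    proof (cases "x \<le> m")
      case True
      have "?J' t \<le> 0" if t: "0 < t" "t \<le> x" for t
      proof -
        have "B * ?d \<le> B * ((m - t) / 2)" using B True t by (intro mult_left_mono) auto
        then show ?thesis
          using su[OF t(1)] chi_weight_pos[OF t(1), of m] t(1) by (intro mult_nonneg_nonpos) auto
      qed
      then show ?thesis
        using deriv lims(1) by (intro nonpos_if_antimono_from_0[OF x, of ?J ?J']) auto
    next
      case False
      have "0 \<le> ?J' t" if t: "x \<le> t" for t
      proof -
        have "B * ?d \<le> B * ((t - m) / 2)" using B False t by (intro mult_left_mono) auto
        then have "0 \<le> s * u t * ?d - B * ((m - t) / 2)"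
          using su[of t] x t by (auto simp: field_simps)
        then show ?thesis
          using chi_weight_pos[of t m] x t by (intro mult_nonneg_nonneg) auto
      qed
      then show ?thesis
        using deriv lims(2) x by (intro nonpos_if_mono_to_infinity[of ?J x ?J']) auto
    qed
    then have "chi_weight m x * (s * ?d * v x) \<le> chi_weight m x * B"
      by (simp add: algebra_simps)
    then show ?thesis
      using chi_weight_pos[OF x, of m] by simp
  qed
  from this[of 1] this[of "-1"] show ?thesis
    by (cases "x \<le> m") (auto simp: abs_if field_simps)
qed

text \<open>By \<open>ode\<close>, the estimated expression is \<open>x\<close> times the derivative
  of \<open>v\<close>.\<close>

lemma slope_bound:
  assumes bound: "\<And>x. 0 < x \<Longrightarrow> \<bar>u x\<bar> \<le> B" and x: "0 < x"
  shows "\<bar>u x - (m - x) / 2 * v x\<bar> \<le> 2 * B"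
  using bound[OF x] drift_bound[OF bound x] by linarith

text \<open>A nondecreasing \<open>u\<close> changes sign at most once, from minus to plus. So
  \<open>chi_weight m x * v x\<close> first decreases from its limit zero at the origin and then
  increases to its limit zero at infinity.\<close>

lemma nonpos_if_mono:
  assumes mono: "\<And>x y. 0 < x \<Longrightarrow> x \<le> y \<Longrightarrow> u x \<le> u y" and x: "0 < x"
  shows "v x \<le> 0"
proof -
  have "chi_weight m x * v x \<le> 0"
  proof (cases "u x \<le> 0")
    case True
    have "chi_weight m t * u t / t \<le> 0" if "0 < t" "t \<le> x" for t
      using mono[of t x] True that chi_weight_pos[of t m]
      by (simp add: divide_nonpos_pos mult_nonneg_nonpos)
    then show ?thesis
      using weighted_deriv by (intro nonpos_if_antimono_from_0[OF x lim_0, of "\<lambda>t. chi_weight m t * u t / t"]) auto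
  next
    case False
    have "0 \<le> chi_weight m t * u t / t" if "x \<le> t" for t
      using mono[of x t] False that x chi_weight_pos[of t m] by simp
    then show ?thesis
      using weighted_deriv x by (intro nonpos_if_mono_to_infinity[OF lim_top, of x "\<lambda>t. chi_weight m t * u t / t"]) auto
  qed
  then show ?thesis
    using chi_weight_pos[OF x, of m] by (simp add: mult_le_0_iff)
qed

end

section \<open>The chi-square law and the solution of its Stein equation\<close>

lemma chi_square_density_integrals:
  assumes "1 \<le> k"
  shows "set_integrable lborel {0..} (chi_square_density k)"
    "(LINT x:{0..}|lborel. chi_square_density k x) = 1"
    "set_integrable lborel {0..} (\<lambda>x. x * chi_square_density k x)"
proof -
  \<comment> \<open>The Gamma integral rescaled by the factor 2; \<open>s = k / 2\<close> gives the
    total mass and \<open>s = k / 2 + 1\<close> the first moment.\<close>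
  have gam: "has_bochner_integral lborel (\<lambda>x. indicator {0..} x *\<^sub>R (x powr (s - 1) * exp (- x / 2))) (2 powr s * Gamma s)"
    if s: "0 < s" for s :: real
  proof -
    have "has_bochner_integral lborel (\<lambda>t. indicator {0..} t * t powr (s - 1) / exp t) (Gamma s)"
      using Gamma_conv_nn_integral_real[OF s] s
      by (intro has_bochner_integral_nn_integral) (auto simp: Gamma_real_pos less_imp_le)
    then have "has_bochner_integral lborel (\<lambda>x. indicator {0..} (0 + (1/2) * x) * (0 + (1/2) * x) powr (s - 1) / exp (0 + (1/2) * x)) (Gamma s /\<^sub>R \<bar>1/2\<bar>)"
      by (subst (asm) lborel_has_bochner_integral_real_affine_iff[where c = "1/2" and t = 0]) auto
    then have "has_bochner_integral lborel (\<lambda>x. 2 powr (s - 1) * (indicator {0..} (0 + (1/2) * x) * (0 + (1/2) * x) powr (s - 1) / exp (0 + (1/2) * x))) (2 powr (s - 1) * (Gamma s /\<^sub>R \<bar>1/2\<bar>))"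
      by (intro has_bochner_integral_mult_right) auto
    moreover have "(2::real) powr (s - 1) * (Gamma s /\<^sub>R \<bar>1/2\<bar>) = 2 powr s * Gamma s"
      by (simp add: powr_diff)
    moreover have "2 powr (s - 1) * (indicator {0..} (0 + (1/2) * x) * (0 + (1/2) * x) powr (s - 1) / exp (0 + (1/2) * x))
        = indicator {0..} x *\<^sub>R (x powr (s - 1) * exp (- x / 2))" for x :: real
      by (auto simp: indicator_def powr_divide exp_minus field_simps)
    ultimately show ?thesis by (simp only:)
  qed
  let ?s = "real k / 2"
  have s: "0 < ?s" using assms by simp
  let ?Z = "2 powr ?s * Gamma ?s"
  have Z: "0 < ?Z" using s by (simp add: Gamma_real_pos)
  have "indicator {0..} x *\<^sub>R (x powr (?s - 1) * exp (- x / 2)) / ?Z = indicator {0..} x *\<^sub>R chi_square_density k x" for x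
    by (simp add: chi_square_density_def indicator_def)
  then have "has_bochner_integral lborel (\<lambda>x. indicator {0..} x *\<^sub>R chi_square_density k x) (?Z / ?Z)"
    using has_bochner_integral_divide[OF gam[OF s], of ?Z] Z by (simp only:)
  then show "set_integrable lborel {0..} (chi_square_density k)"
    "(LINT x:{0..}|lborel. chi_square_density k x) = 1"
    using Z by (auto simp: set_integrable_def set_lebesgue_integral_def has_bochner_integral_iff)
  have "indicator {0..} x *\<^sub>R (x powr (?s + 1 - 1) * exp (- x / 2)) / ?Z = indicator {0..} x *\<^sub>R (x * chi_square_density k x)" for x
    by (cases "x = 0") (simp_all add: chi_square_density_def indicator_def powr_diff)
  then have "has_bochner_integral lborel (\<lambda>x. indicator {0..} x *\<^sub>R (x * chi_square_density k x)) (2 powr (?s + 1) * Gamma (?s + 1) / ?Z)"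
    using has_bochner_integral_divide[OF gam[of "?s + 1"], of ?Z] Z s by (simp only: add_pos_pos zero_less_one)
  then show "set_integrable lborel {0..} (\<lambda>x. x * chi_square_density k x)"
    by (auto simp: set_integrable_def set_lebesgue_integral_def has_bochner_integral_iff)
qed

lemma chi_square_density_nonneg: "0 \<le> chi_square_density k x"
  by (cases "k = 0") (auto simp: chi_square_density_def intro!: mult_nonneg_nonneg divide_nonneg_nonneg less_imp_le[OF Gamma_real_pos])

lemma chi_square_density_measurable [measurable]: "chi_square_density k \<in> borel_measurable borel"
  unfolding chi_square_density_def by measurable

lemma chi_square_density_eq_weight:
  "0 < x \<Longrightarrow> chi_square_density k x = chi_weight (real k) x / (x * (2 powr (real k / 2) * Gamma (real k / 2)))"
  by (simp add: chi_square_density_def chi_weight_def powr_diff)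

text \<open>Affine growth is allowed because functions in \<open>Cb_from_to 1 2\<close> are
  Lipschitz but possibly unbounded; the finite mean of the law suffices.\<close>

lemma affine_bound_set_integrable:
  assumes k: "1 \<le> k" and cont: "continuous_on {0..} h" and bound: "\<And>x. 0 \<le> x \<Longrightarrow> \<bar>h x\<bar> \<le> A + B * x"
  shows "set_integrable lborel {0..} (\<lambda>x. chi_square_density k x * h x)"
proof -
  have "set_integrable lborel {0..} (\<lambda>x. A * chi_square_density k x + B * (x * chi_square_density k x))"
    using chi_square_density_integrals[OF k] by (intro set_integral_add set_integrable_mult_right)
  then show ?thesis
  proof (rule set_integrable_bound)
    have "(\<lambda>x. indicator {0..} x *\<^sub>R h x) \<in> borel_measurable borel"
      using cont by (intro borel_measurable_continuous_on_indicator) auto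
    then have "(\<lambda>x. chi_square_density k x * (indicator {0..} x *\<^sub>R h x)) \<in> borel_measurable borel"
      by measurable
    then show "set_borel_measurable lborel {0..} (\<lambda>x. chi_square_density k x * h x)"
      by (simp add: set_borel_measurable_def mult_ac)
    have "\<bar>chi_square_density k x * h x\<bar> \<le> \<bar>A * chi_square_density k x + B * (x * chi_square_density k x)\<bar>"
      if x: "0 \<le> x" for x
    proof -
      have "chi_square_density k x * \<bar>h x\<bar> \<le> chi_square_density k x * (A + B * x)"
        by (intro mult_left_mono bound chi_square_density_nonneg x)
      also have "\<dots> \<le> \<bar>A * chi_square_density k x + B * (x * chi_square_density k x)\<bar>"
        by (simp add: algebra_simps)
      finally show ?thesis by (simp add: abs_mult chi_square_density_nonneg)
    qed
    then show "AE x in lborel. x \<in> {0..} \<longrightarrow>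
        norm (chi_square_density k x * h x) \<le> norm (A * chi_square_density k x + B * (x * chi_square_density k x))"
      by simp
  qed
qed

lemma chi_square_expectation_eq:
  assumes "continuous_on {0..} h"
  shows "chi_square_expectation k h = (LINT x:{0..}|lborel. chi_square_density k x * h x)"
proof -
  have "(\<lambda>x. indicator {0..} x *\<^sub>R h x) \<in> borel_measurable borel"
    using assms by (intro borel_measurable_continuous_on_indicator) auto
  then show ?thesis
    unfolding chi_square_expectation_def chi_square_def set_lebesgue_integral_def
    by (subst integral_density) (auto simp: chi_square_density_nonneg mult_ac)
qed

lemma abs_chi_square_expectation_le:
  assumes k: "1 \<le> k" and cont: "continuous_on {0..} h" and bound: "\<And>x. 0 \<le> x \<Longrightarrow> \<bar>h x\<bar> \<le> B"
  shows "\<bar>chi_square_expectation k h\<bar> \<le> B"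
proof -
  have int: "set_integrable lborel {0..} (\<lambda>x. chi_square_density k x * h x)"
    using affine_bound_set_integrable[OF k cont, of B 0] bound by simp
  have "norm (LINT x:{0..}|lborel. chi_square_density k x * h x) \<le> (LINT x:{0..}|lborel. norm (chi_square_density k x * h x))"
    by (rule set_integral_norm_bound[OF int])
  also have "\<dots> \<le> (LINT x:{0..}|lborel. B * chi_square_density k x)"
    using bound chi_square_density_integrals(1)[OF k]
    by (intro set_integral_mono set_integrable_norm int set_integrable_mult_right)
       (auto simp: abs_mult chi_square_density_nonneg mult.commute[of B] intro!: mult_left_mono)
  also have "\<dots> = B"
    by (simp add: chi_square_density_integrals(2)[OF k])
  finally show ?thesis by (simp add: chi_square_expectation_eq[OF cont])
qed

text \<open>Variation of constants: the solution is the integral of the centred \<open>h\<close>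
  against the density over \<open>{0..x}\<close>, divided by the weight. Centring makes the full
  integral zero, which yields the limit at infinity.\<close>

lemma stein_solution_exists:
  assumes k: "1 \<le> k" and cont: "continuous_on {0..} h" and bound: "\<And>x. 0 \<le> x \<Longrightarrow> \<bar>h x\<bar> \<le> A + B * x"
  obtains g where "chi_ode (real k) g (\<lambda>x. h x - chi_square_expectation k h)"
proof -
  let ?c = "chi_square_expectation k h"
  define f where "f = (\<lambda>t. chi_square_density k t * (h t - ?c))"
  define K where "K = (\<lambda>x. LINT t:{0..x}|lborel. f t)"
  define Z where "Z = 2 powr (real k / 2) * Gamma (real k / 2)"
  have Z: "0 < Z" using k by (simp add: Z_def Gamma_real_pos)
  have cont': "continuous_on {0..} (\<lambda>x. h x - ?c)"
    by (intro continuous_intros cont)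
  have int: "set_integrable lborel {0..} f"
    unfolding f_def
  proof (rule affine_bound_set_integrable[OF k cont'])
    show "\<bar>h x - ?c\<bar> \<le> (A + \<bar>?c\<bar>) + B * x" if "0 \<le> x" for x
      using bound[OF that] by linarith
  qed
  have "(LINT t:{0..}|lborel. f t) = (LINT t:{0..}|lborel. chi_square_density k t * h t - ?c * chi_square_density k t)"
    by (simp add: f_def algebra_simps)
  also have "\<dots> = ?c - ?c * 1"
    using affine_bound_set_integrable[OF k cont bound] chi_square_density_integrals(1,2)[OF k]
    by (subst set_integral_diff(2)) (auto simp: chi_square_expectation_eq[OF cont])
  finally have zero: "(LINT t:{0..}|lborel. f t) = 0" by simp
  have int': "set_integrable lborel {a..b} f" if "0 \<le> a" for a b
    using that by (intro set_integrable_subset[OF int]) auto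
  have K_integral: "K x = integral {0..x} f" for x
    unfolding K_def using set_borel_integral_eq_integral(2)[OF int'[of 0 x]] by simp
  have lim_top: "(K \<longlongrightarrow> 0) at_top"
    using tendsto_set_lebesgue_integral_at_top[OF _ int] zero unfolding K_def by simp
  have lim_0: "(K \<longlongrightarrow> 0) (at_right 0)"
  proof -
    have "continuous_on {0..1} K"
      unfolding K_integral[abs_def]
      by (rule indefinite_integral_continuous_1) (use set_borel_integral_eq_integral(1)[OF int'[of 0 1]] in simp)
    then have "(K \<longlongrightarrow> K 0) (at 0 within {0..1})"
      by (simp add: continuous_on_def)
    moreover have "at 0 within {0..1} = at_right (0::real)"
      by (rule at_within_Icc_at_right) simp
    ultimately show ?thesis by (simp add: K_integral)
  qed
  have K_deriv: "(K has_real_derivative f x) (at x)" if x: "0 < x" for x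
  proof -
    \<comment> \<open>The integral is differentiated from the base point \<open>x/2\<close>, away
      from the origin, near which the density is unbounded for \<open>k = 1\<close>.\<close>
    have contf: "continuous_on {x/2..2*x} f"
    proof (rule continuous_on_eq)
      show "continuous_on {x/2..2*x} (\<lambda>t. t powr (real k / 2 - 1) * exp (- t / 2) / Z * (h t - ?c))"
        using x Z by (intro continuous_intros continuous_on_subset[OF cont]) auto
    qed (use x in \<open>auto simp: f_def chi_square_density_def Z_def\<close>)
    have "((\<lambda>y. integral {x/2..y} f) has_real_derivative f x) (at x within {x/2..2*x})"
      using x by (intro integral_has_real_derivative contf) auto
    then have "((\<lambda>y. integral {x/2..y} f) has_real_derivative f x) (at x)"
      using x by (simp add: at_within_Icc_at)
    then have "((\<lambda>y. K (x/2) + integral {x/2..y} f) has_real_derivative f x) (at x)"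
      by (auto intro!: derivative_eq_intros)
    moreover have "\<forall>\<^sub>F y in nhds x. K y = K (x/2) + integral {x/2..y} f"
    proof -
      have "K y = K (x/2) + integral {x/2..y} f" if "y \<in> {x/2<..}" for y
        unfolding K_integral using that x set_borel_integral_eq_integral(1)[OF int'[of 0 y]]
        by (intro Henstock_Kurzweil_Integration.integral_combine[symmetric]) auto
      moreover have "\<forall>\<^sub>F y in nhds x. y \<in> {x/2<..}"
        using x by (intro eventually_nhds_in_open) auto
      ultimately show ?thesis by (auto elim: eventually_mono)
    qed
    ultimately show ?thesis
      by (subst DERIV_cong_ev[OF refl _ refl]) auto
  qed
  define g where "g = (\<lambda>x. Z * K x / chi_weight k x)"
  have wg: "chi_weight k x * g x = Z * K x" if "0 < x" for x
    using chi_weight_pos[OF that, of k] by (simp add: g_def)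
  have "chi_ode (real k) g (\<lambda>x. h x - ?c)"
  proof
    show "0 < real k" using k by simp
    fix x :: real assume x: "0 < x"
    have fx: "Z * f x = chi_weight k x * (h x - ?c) / x"
      using x Z by (simp add: f_def chi_square_density_eq_weight flip: Z_def)
    have "(g has_real_derivative (Z * f x * chi_weight k x - Z * K x * ((k - x) / 2 * chi_weight k x / x)) / (chi_weight k x * chi_weight k x)) (at x)"
      unfolding g_def using chi_weight_pos[OF x, of k]
      by (intro DERIV_divide DERIV_cmult K_deriv chi_weight_deriv x) auto
    then show "(g has_real_derivative (h x - ?c - (k - x) / 2 * g x) / x) (at x)"
      by (rule DERIV_cong) (use x chi_weight_pos[OF x, of k] in \<open>simp add: fx g_def field_simps\<close>)
  next
    have ev: "\<forall>\<^sub>F x in at_right 0. Z * K x = chi_weight k x * g x" "\<forall>\<^sub>F x in at_top. Z * K x = chi_weight k x * g x"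
      using wg by (auto simp: eventually_at_filter eventually_at_top_dense intro!: always_eventually exI[of _ 0])
    show "((\<lambda>x. chi_weight k x * g x) \<longlongrightarrow> 0) (at_right 0)"
      using tendsto_mult_left[OF lim_0, of Z] by (subst (asm) tendsto_cong[OF ev(1)]) simp
    show "((\<lambda>x. chi_weight k x * g x) \<longlongrightarrow> 0) at_top"
      using tendsto_mult_left[OF lim_top, of Z] by (subst (asm) tendsto_cong[OF ev(2)]) simp
  qed
  then show thesis by (rule that)
qed

section \<open>Bounds on the derivatives of the Stein solution\<close>

lemma chi_weight_shift_lim:
  assumes m: "0 < m" and bound: "\<And>x. 0 < x \<Longrightarrow> \<bar>x * w x\<bar> \<le> A + B * x"
  shows "((\<lambda>x. chi_weight (m + 2) x * w x) \<longlongrightarrow> 0) (at_right 0)"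
    and "((\<lambda>x. chi_weight (m + 2) x * w x) \<longlongrightarrow> 0) at_top"
proof -
  \<comment> \<open>Two more degrees of freedom supply one factor \<open>x\<close>, so affine growth
    of \<open>x * w x\<close> is enough.\<close>
  have eq: "chi_weight m x * (x * w x) = chi_weight (m + 2) x * w x" if "0 < x" for x
    using that by (simp add: chi_weight_add_2)
  have ev: "\<forall>\<^sub>F x in at_right 0. chi_weight m x * (x * w x) = chi_weight (m + 2) x * w x"
    "\<forall>\<^sub>F x in at_top. chi_weight m x * (x * w x) = chi_weight (m + 2) x * w x"
    using eq by (auto simp: eventually_at_filter eventually_at_top_dense intro!: always_eventually exI[of _ 0])
  show "((\<lambda>x. chi_weight (m + 2) x * w x) \<longlongrightarrow> 0) (at_right 0)"
    using chi_weight_affine_lim(1)[OF m bound] tendsto_cong[OF ev(1)] by blast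
  show "((\<lambda>x. chi_weight (m + 2) x * w x) \<longlongrightarrow> 0) at_top"
    using chi_weight_affine_lim(2)[OF m bound] tendsto_cong[OF ev(2)] by blast
qed

locale stein_equation =
  fixes k :: nat and h h1 h2 g :: "real \<Rightarrow> real" and c H1 H2 :: real
  assumes k: "1 \<le> k"
    and h_deriv: "0 \<le> x \<Longrightarrow> (h has_real_derivative h1 x) (at x within {0..})"
    and h1_deriv: "0 \<le> x \<Longrightarrow> (h1 has_real_derivative h2 x) (at x within {0..})"
    and h1_bound: "0 \<le> x \<Longrightarrow> \<bar>h1 x\<bar> \<le> H1"
    and h2_bound: "0 \<le> x \<Longrightarrow> \<bar>h2 x\<bar> \<le> H2"
    and g: "chi_ode (real k) g (\<lambda>x. h x - c)"
begin

abbreviation "m \<equiv> real k + 2"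

text \<open>\<open>g1\<close>, \<open>g2\<close>, \<open>g3\<close> are the successive derivatives
  of \<open>g\<close>, read off from the Stein equation and its differentiated forms. Each
  differentiation raises the degrees of freedom by two and adds half of the differentiated solution
  to the derivative of the right-hand side.\<close>

definition "g1 x = (h x - c - (real k - x) / 2 * g x) / x"
definition "g2 x = (h1 x + g x / 2 - (m - x) / 2 * g1 x) / x"
definition "g3 x = (h2 x + g1 x - (m + 2 - x) / 2 * g2 x) / x"

lemma h_lipschitz: "0 \<le> x \<Longrightarrow> 0 \<le> y \<Longrightarrow> \<bar>h x - h y\<bar> \<le> H1 * \<bar>x - y\<bar>"
  using field_differentiable_bound[of "{0..}" h h1 H1 x y] h_deriv h1_bound by simp

lemma at_pos: "0 < x \<Longrightarrow> at x within {0..} = at (x::real)"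
  by (rule at_within_interior) simp

lemma g_deriv: "0 < x \<Longrightarrow> (g has_real_derivative g1 x) (at x)"
  using chi_ode.ode[OF g] by (simp add: g1_def)

lemma stein_eq:
  assumes "0 < x"
  shows "real k / 2 * g x + x * g1 x - x / 2 * g x = h x - c"
proof -
  have "x * g1 x = h x - c - (real k - x) / 2 * g x"
    using assms by (simp add: g1_def)
  also have "(real k - x) / 2 * g x = real k / 2 * g x - x / 2 * g x"
    by (simp add: diff_divide_distrib left_diff_distrib)
  finally show ?thesis by simp
qed

lemma g1_deriv:
  assumes x: "0 < x"
  shows "(g1 has_real_derivative g2 x) (at x)"
proof -
  have "(h has_real_derivative h1 x) (at x)"
    using h_deriv[of x] x at_pos by simp
  note [derivative_intros] = this g_deriv[OF x]
  show ?thesis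
    unfolding g1_def[abs_def]
    by (rule derivative_eq_intros refl | use x in \<open>simp; fail\<close>)+
       (use x in \<open>simp add: g2_def g1_def field_simps\<close>)
qed

lemma g2_deriv:
  assumes x: "0 < x"
  shows "(g2 has_real_derivative g3 x) (at x)"
proof -
  have "(h1 has_real_derivative h2 x) (at x)"
    using h1_deriv[of x] x at_pos by simp
  note [derivative_intros] = this g_deriv[OF x] g1_deriv[OF x]
  show ?thesis
    unfolding g2_def[abs_def]
    by (rule derivative_eq_intros refl | use x in \<open>simp; fail\<close>)+
       (use x in \<open>simp add: g3_def g2_def field_simps\<close>)
qed

text \<open>The Stein equation for \<open>h x = x\<close> has the solution \<open>-2\<close>, and \<open>H1 * x \<plusminus> h x\<close> is nondecreasing.\<close>

lemma g_bound:
  assumes x: "0 < x"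
  shows "\<bar>g x\<bar> \<le> 2 * H1"
proof -
  have "s * g x - 2 * H1 \<le> 0" if s: "\<bar>s\<bar> = 1" for s
  proof -
    interpret chi_ode "real k" "\<lambda>x. s * g x - 2 * H1" "\<lambda>x. H1 * (x - real k) + s * (h x - c)"
    proof
      show "0 < real k" using k by simp
      fix x :: real assume x: "0 < x"
      show "((\<lambda>x. s * g x - 2 * H1) has_real_derivative
          (H1 * (x - real k) + s * (h x - c) - (real k - x) / 2 * (s * g x - 2 * H1)) / x) (at x)"
        by (rule derivative_eq_intros g_deriv x refl)+ (use x in \<open>simp add: g1_def field_simps\<close>)
    next
      have *: "(\<lambda>x. chi_weight k x * (s * g x - 2 * H1)) = (\<lambda>x. s * (chi_weight k x * g x) - 2 * H1 * (chi_weight k x * 1))"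
        by (simp add: algebra_simps)
      have 1: "0 < real k" "\<And>x. 0 < x \<Longrightarrow> \<bar>1::real\<bar> \<le> 1 + 0 * x" using k by auto
      show "((\<lambda>x. chi_weight k x * (s * g x - 2 * H1)) \<longlongrightarrow> 0) (at_right 0)"
        unfolding * using tendsto_diff[OF tendsto_mult_left[OF chi_ode.lim_0[OF g], of s] tendsto_mult_left[OF chi_weight_affine_lim(1)[OF 1], of "2 * H1"]]
        by simp
      show "((\<lambda>x. chi_weight k x * (s * g x - 2 * H1)) \<longlongrightarrow> 0) at_top"
        unfolding * using tendsto_diff[OF tendsto_mult_left[OF chi_ode.lim_top[OF g], of s] tendsto_mult_left[OF chi_weight_affine_lim(2)[OF 1], of "2 * H1"]]
        by simp
    qed
    show ?thesis
    proof (rule nonpos_if_mono[OF _ x])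
      fix x y :: real assume "0 < x" "x \<le> y"
      then have "\<bar>s * (h x - h y)\<bar> \<le> H1 * (y - x)"
        using h_lipschitz[of x y] s by (simp add: abs_mult)
      then show "H1 * (x - real k) + s * (h x - c) \<le> H1 * (y - real k) + s * (h y - c)"
        by (simp add: algebra_simps abs_le_iff)
    qed
  qed
  from this[of 1] this[of "-1"] show ?thesis by auto
qed

lemma g1_ode: "chi_ode m g1 (\<lambda>x. h1 x + g x / 2)"
proof
  show "0 < m" using k by simp
  show "(g1 has_real_derivative (h1 x + g x / 2 - (m - x) / 2 * g1 x) / x) (at x)" if "0 < x" for x
    using g1_deriv[OF that] by (simp add: g2_def)
  \<comment> \<open>In the Stein equation \<open>h\<close> grows affinely and \<open>g\<close> is
    bounded, so \<open>x * g1 x\<close> grows affinely and the shifted weight gives both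
    limits.\<close>
  have bd: "\<bar>x * g1 x\<bar> \<le> (\<bar>h 0\<bar> + \<bar>c\<bar> + real k * H1) + 2 * H1 * x" if x: "0 < x" for x
  proof -
    have "\<bar>(real k - x) / 2 * g x\<bar> \<le> (real k + x) / 2 * (2 * H1)"
      unfolding abs_mult using g_bound[OF x] x by (intro mult_mono) auto
    moreover have "\<bar>h x\<bar> \<le> \<bar>h 0\<bar> + H1 * x"
      using h_lipschitz[of x 0] x by auto
    moreover have "x * g1 x = h x - c - (real k - x) / 2 * g x"
      using x by (simp add: g1_def)
    moreover have "(real k + x) / 2 * (2 * H1) = real k * H1 + H1 * x"
      by (simp add: field_simps)
    ultimately show ?thesis by linarith
  qed
  have k0: "0 < real k" using k by simp
  show "((\<lambda>x. chi_weight m x * g1 x) \<longlongrightarrow> 0) (at_right 0)" "((\<lambda>x. chi_weight m x * g1 x) \<longlongrightarrow> 0) at_top"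
    by (rule chi_weight_shift_lim[OF k0 bd]; assumption)+
qed

lemma g1_rhs_bound: "0 < x \<Longrightarrow> \<bar>h1 x + g x / 2\<bar> \<le> 2 * H1"
  using h1_bound[of x] g_bound[of x] by auto

lemma g1_drift: "0 < x \<Longrightarrow> \<bar>(m - x) / 2 * g1 x\<bar> \<le> 2 * H1"
  by (rule chi_ode.drift_bound[OF g1_ode g1_rhs_bound])

lemma x_g2_bound:
  assumes "0 < x" shows "\<bar>x * g2 x\<bar> \<le> 4 * H1"
  using chi_ode.slope_bound[OF g1_ode g1_rhs_bound assms] assms by (simp add: g2_def)

lemma g2_ode: "chi_ode (m + 2) g2 (\<lambda>x. h2 x + g1 x)"
proof
  show "0 < m + 2" using k by simp
  show "(g2 has_real_derivative (h2 x + g1 x - (m + 2 - x) / 2 * g2 x) / x) (at x)" if "0 < x" for x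
    using g2_deriv[OF that] by (simp add: g3_def)
  have bd: "\<bar>x * g2 x\<bar> \<le> 4 * H1 + 0 * x" if "0 < x" for x
    using x_g2_bound[OF that] by simp
  have m0: "0 < m" using k by simp
  show "((\<lambda>x. chi_weight (m + 2) x * g2 x) \<longlongrightarrow> 0) (at_right 0)" "((\<lambda>x. chi_weight (m + 2) x * g2 x) \<longlongrightarrow> 0) at_top"
    by (rule chi_weight_shift_lim[OF m0 bd]; assumption)+
qed

text \<open>The equation for \<open>g1\<close> bounds \<open>x * g2 x\<close>, the one for
  \<open>g2\<close> bounds \<open>(m + 2 - x) * g2 x\<close>; in the sum \<open>x\<close> cancels.
  \<open>B\<close> stays abstract since two different bounds on \<open>g1\<close> are inserted
  later.\<close>

lemma g2_bound:
  assumes B: "\<And>x. 0 < x \<Longrightarrow> \<bar>g1 x\<bar> \<le> B" and x: "0 < x"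
  shows "\<bar>g2 x\<bar> \<le> 2 * (2 * H1 + H2 + B) / (m + 2)"
proof -
  have "\<bar>(m + 2 - x) / 2 * g2 x\<bar> \<le> H2 + B"
  proof (rule chi_ode.drift_bound[OF g2_ode _ x])
    show "\<bar>h2 x + g1 x\<bar> \<le> H2 + B" if "0 < x" for x
      using h2_bound[of x] B[OF that] that by auto
  qed
  then have "\<bar>(m + 2 - x) / 2 * g2 x + x * g2 x / 2\<bar> \<le> 2 * H1 + H2 + B"
    using x_g2_bound[OF x] by linarith
  also have "(m + 2 - x) / 2 * g2 x + x * g2 x / 2 = (m + 2) * g2 x / 2"
    by (simp add: field_simps)
  finally show ?thesis
    by (simp add: abs_mult field_simps)
qed

text \<open>The bounds on \<open>(m - x) g1 x / 2\<close> and \<open>x g1 x / 2\<close> add up to one on \<open>m g1 x / 2\<close>.\<close>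

lemma g1_bound_of_bounded:
  assumes H0: "\<And>x. 0 < x \<Longrightarrow> \<bar>h x - c\<bar> \<le> 2 * H0" and x: "0 < x"
  shows "\<bar>g1 x\<bar> \<le> 4 * (H0 + H1) / m"
proof -
  have "\<bar>x * g1 x\<bar> \<le> 4 * H0"
    using chi_ode.slope_bound[OF g H0 x] x by (simp add: g1_def)
  moreover have "\<bar>a + b / 2\<bar> \<le> 2 * (H0 + H1)" if "\<bar>a\<bar> \<le> 2 * H1" "\<bar>b\<bar> \<le> 4 * H0" for a b :: real
    using that by (auto simp: abs_le_iff field_simps)
  ultimately have "\<bar>(m - x) / 2 * g1 x + x * g1 x / 2\<bar> \<le> 2 * (H0 + H1)"
    using g1_drift[OF x] by blast
  also have "(m - x) / 2 * g1 x + x * g1 x / 2 = m * g1 x / 2"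
    by (simp add: field_simps)
  finally show ?thesis
    by (simp add: abs_mult field_simps)
qed

text \<open>Away from \<open>m\<close> the drift term controls \<open>g1\<close>. Near \<open>m\<close>, move right by \<open>sqrt m\<close>,
  paying with the slope.\<close>

lemma g1_bound:
  assumes x: "0 < x"
  shows "\<bar>g1 x\<bar> \<le> 16 * H1 / sqrt m"
proof -
  let ?r = "sqrt m"
  have r: "0 < ?r" "?r * ?r = m" "1 \<le> ?r" by auto
  have "0 \<le> H1" using h1_bound[of 0] by simp
  have far: "\<bar>g1 y\<bar> \<le> 8 * H1 / ?r" if y: "0 < y" "?r / 2 \<le> \<bar>m - y\<bar>" for y
  proof -
    have "?r / 2 * \<bar>g1 y\<bar> \<le> \<bar>m - y\<bar> * \<bar>g1 y\<bar>"
      using y by (intro mult_right_mono) auto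
    also have "\<dots> \<le> 4 * H1"
      using g1_drift[OF y(1)] by (simp add: abs_mult)
    finally show ?thesis using r by (simp add: field_simps)
  qed
  show ?thesis
  proof (cases "?r / 2 \<le> \<bar>m - x\<bar>")
    case True
    then show ?thesis
      using far[OF x] \<open>0 \<le> H1\<close> r by (intro order_trans[OF far[OF x True]] divide_right_mono) auto
  next
    case False
    have "?r \<le> m" using r by (metis less_imp_le mult.right_neutral mult_left_mono)
    moreover have "m - x < ?r / 2" using False abs_ge_self[of "m - x"] by linarith
    ultimately have xm: "m / 2 \<le> x" by (auto simp: field_simps)
    have "\<bar>g1 (x + ?r) - g1 x\<bar> \<le> (8 * H1 / m) * \<bar>x + ?r - x\<bar>"
    proof (rule field_differentiable_bound[of "{x..x + ?r}" g1 g2, simplified])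
      fix z assume z: "x \<le> z \<and> z \<le> x + ?r"
      then have "0 < z" using x by simp
      show "(g1 has_real_derivative g2 z) (at z within {x..x + ?r})"
        using g1_deriv[OF \<open>0 < z\<close>] by (rule DERIV_subset) simp
      have "m / 2 * \<bar>g2 z\<bar> \<le> \<bar>z\<bar> * \<bar>g2 z\<bar>"
        using z xm by (intro mult_right_mono) auto
      also have "\<dots> \<le> 4 * H1" using x_g2_bound[OF \<open>0 < z\<close>] by (simp add: abs_mult)
      finally show "\<bar>g2 z\<bar> \<le> 8 * H1 / m" by (simp add: field_simps)
    qed (use r in auto)
    also have "\<dots> = 8 * H1 / ?r"
      using r by (simp add: field_simps)
    finally have "\<bar>g1 (x + ?r) - g1 x\<bar> \<le> 8 * H1 / ?r" .
    moreover have "\<bar>g1 (x + ?r)\<bar> \<le> 8 * H1 / ?r"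
    proof (rule far)
      show "0 < x + ?r" using x r(1) by (rule add_pos_pos)
      have "s / 2 \<le> \<bar>a - (b + s)\<bar>" if "\<not> s / 2 \<le> \<bar>a - b\<bar>" for a b s :: real
        using that by (auto simp: abs_if split: if_splits)
      then show "?r / 2 \<le> \<bar>m - (x + ?r)\<bar>" using False .
    qed
    ultimately show ?thesis by linarith
  qed
qed

lemma second_order_expansion:
  assumes B: "\<And>x. 0 < x \<Longrightarrow> \<bar>g1 x\<bar> \<le> B" and x: "0 < x" and y: "0 < y"
  shows "\<bar>g y - g x - g1 x * (y - x)\<bar> \<le> (2 * H1 + H2 + B) / (m + 2) * (y - x)\<^sup>2"
proof (cases "x = y")
  case False
  define diff where "diff i = (if i = 0 then g else if i = 1 then g1 else g2)" for i :: nat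
  have "\<exists>t. (if y < x then y < t \<and> t < x else x < t \<and> t < y) \<and>
      g y = (\<Sum>i<2. diff i x / fact i * (y - x) ^ i) + diff 2 t / fact 2 * (y - x)\<^sup>2"
  proof (rule Taylor[where a = "min x y" and b = "max x y"])
    show "\<forall>i t. i < 2 \<and> min x y \<le> t \<and> t \<le> max x y \<longrightarrow> (diff i has_real_derivative diff (Suc i) t) (at t)"
      using x y g_deriv g1_deriv by (auto simp: diff_def less_2_cases_iff)
  qed (use False in \<open>auto simp: diff_def\<close>)
  then obtain t where "if y < x then y < t \<and> t < x else x < t \<and> t < y"
    and exp: "g y = (\<Sum>i<2. diff i x / fact i * (y - x) ^ i) + diff 2 t / fact 2 * (y - x)\<^sup>2"
    by blast
  then have t: "0 < t" using x y by (auto split: if_splits)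
  have exp: "g y = g x + g1 x * (y - x) + g2 t / 2 * (y - x)\<^sup>2"
    using exp by (simp add: diff_def lessThan_Suc numeral_2_eq_2)
  have "\<bar>g2 t / 2\<bar> \<le> (2 * H1 + H2 + B) / (m + 2)"
    using g2_bound[OF B t] by (simp add: field_simps)
  from mult_right_mono[OF this zero_le_power2[of "y - x"]]
  have "\<bar>g2 t / 2 * (y - x)\<^sup>2\<bar> \<le> (2 * H1 + H2 + B) / (m + 2) * (y - x)\<^sup>2"
    by (simp add: abs_mult)
  then show ?thesis using exp by simp
qed simp

text \<open>The derivative is \<open>m / 2 * g1 z + z * g2 z\<close>, where the product rule has
  raised \<open>k / 2\<close> to \<open>m / 2\<close>.\<close>

lemma generator_lipschitz:
  assumes B: "\<And>x. 0 < x \<Longrightarrow> \<bar>g1 x\<bar> \<le> B" and x: "0 < x" and y: "0 < y"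
  shows "\<bar>(real k / 2 * g y + y * g1 y) - (real k / 2 * g x + x * g1 x)\<bar> \<le> (m / 2 * B + 4 * H1) * \<bar>y - x\<bar>"
proof -
  have "norm ((real k / 2 * g y + y * g1 y) - (real k / 2 * g x + x * g1 x)) \<le> (m / 2 * B + 4 * H1) * norm (y - x)"
  proof (rule field_differentiable_bound[of "{0<..}"])
    fix z :: real assume "z \<in> {0<..}"
    then have z: "0 < z" by simp
    show "((\<lambda>z. real k / 2 * g z + z * g1 z) has_real_derivative m / 2 * g1 z + z * g2 z) (at z within {0<..})"
      by (rule DERIV_subset[where s = UNIV])
         (rule derivative_eq_intros g_deriv[OF z] g1_deriv[OF z] refl | simp add: field_simps)+
    have "\<bar>m / 2 * g1 z\<bar> \<le> m / 2 * B"
      using B[OF z] by (simp add: abs_mult)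
    then show "norm (m / 2 * g1 z + z * g2 z) \<le> m / 2 * B + 4 * H1"
      using x_g2_bound[OF z] abs_triangle_ineq[of "m / 2 * g1 z" "z * g2 z"] by (simp only: real_norm_def)
  qed (use x y in auto)
  then show ?thesis by simp
qed

end

lemma le_at_0_of_continuous:
  fixes \<phi> :: "real \<Rightarrow> real"
  assumes "continuous_on {0..} \<phi>" "\<And>e. 0 < e \<Longrightarrow> \<phi> e \<le> a"
  shows "\<phi> 0 \<le> a"
  by (rule continuous_le_on_closure[of "{0<..}" \<phi>]) (use assms in auto)

text \<open>On the open half-line \<open>g\<close> and \<open>g1\<close> are Lipschitz; their continuous extensions to \<open>0\<close>, a value that
  Pearson's statistic may take, inherit all estimates.\<close>

lemma stein_factors:
  fixes h :: "real \<Rightarrow> real"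
  assumes k: "1 \<le> k"
    and h_deriv: "\<And>x. 0 \<le> x \<Longrightarrow> (h has_real_derivative h1 x) (at x within {0..})"
    and h1_deriv: "\<And>x. 0 \<le> x \<Longrightarrow> (h1 has_real_derivative h2 x) (at x within {0..})"
    and h1_bound: "\<And>x. 0 \<le> x \<Longrightarrow> \<bar>h1 x\<bar> \<le> H1"
    and h2_bound: "\<And>x. 0 \<le> x \<Longrightarrow> \<bar>h2 x\<bar> \<le> H2"
  obtains g g1 where
    "\<And>x. 0 \<le> x \<Longrightarrow> real k / 2 * g x + x * g1 x - x / 2 * g x = h x - chi_square_expectation k h"
    "\<And>x. 0 \<le> x \<Longrightarrow> \<bar>g1 x\<bar> \<le> 16 * H1 / sqrt (real k + 2)"
    "\<And>H0 x. (\<And>x. 0 \<le> x \<Longrightarrow> \<bar>h x\<bar> \<le> H0) \<Longrightarrow> 0 \<le> x \<Longrightarrow> \<bar>g1 x\<bar> \<le> 4 * (H0 + H1) / (real k + 2)"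
    "\<And>B x y. (\<And>x. 0 \<le> x \<Longrightarrow> \<bar>g1 x\<bar> \<le> B) \<Longrightarrow> 0 \<le> x \<Longrightarrow> 0 \<le> y \<Longrightarrow>
       \<bar>g y - g x - g1 x * (y - x)\<bar> \<le> (2 * H1 + H2 + B) / (real k + 4) * (y - x)\<^sup>2"
    "\<And>B x y. (\<And>x. 0 \<le> x \<Longrightarrow> \<bar>g1 x\<bar> \<le> B) \<Longrightarrow> 0 \<le> x \<Longrightarrow> 0 \<le> y \<Longrightarrow>
       \<bar>(real k / 2 * g y + y * g1 y) - (real k / 2 * g x + x * g1 x)\<bar>
         \<le> ((real k + 2) / 2 * B + 4 * H1) * \<bar>y - x\<bar>"
proof -
  let ?c = "chi_square_expectation k h"
  have cont: "continuous_on {0..} h"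
    using h_deriv by (intro DERIV_continuous_on) auto
  have "\<bar>h x\<bar> \<le> \<bar>h 0\<bar> + H1 * x" if "0 \<le> x" for x
    using field_differentiable_bound[of "{0..}" h h1 H1 x 0] h_deriv h1_bound that by auto
  then obtain g where g: "chi_ode (real k) g (\<lambda>x. h x - ?c)"
    using stein_solution_exists[OF k cont] by blast
  interpret stein_equation k h h1 h2 g ?c H1 H2
    by (rule stein_equation.intro; fact)
  have "0 \<le> H1" "0 \<le> H2" using h1_bound[of 0] h2_bound[of 0] by auto
  have lip: "\<exists>f'. continuous_on {0..} f' \<and> (\<forall>x>0. f' x = f x)"
    if f: "\<And>x. 0 < x \<Longrightarrow> (f has_real_derivative f1 x) (at x)" "\<And>x. 0 < x \<Longrightarrow> \<bar>f1 x\<bar> \<le> L" for f f1 :: "real \<Rightarrow> real" and L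
  proof -
    have "L-lipschitz_on {0<..} f"
    proof (rule lipschitz_onI)
      show "0 \<le> L" using f(2)[of 1] by simp
      show "dist (f x) (f y) \<le> L * dist x y" if "x \<in> {0<..}" "y \<in> {0<..}" for x y
        using field_differentiable_bound[of "{0<..}" f f1 L x y] f that
        by (auto simp: dist_norm intro: DERIV_subset)
    qed
    from lipschitz_extend_closure[OF this] show ?thesis
      by (auto dest: lipschitz_on_continuous_on)
  qed
  obtain G where G: "continuous_on {0..} G" "\<And>x. 0 < x \<Longrightarrow> G x = g x"
    using lip[OF g_deriv g1_bound] by blast
  obtain G1 where G1: "continuous_on {0..} G1" "\<And>x. 0 < x \<Longrightarrow> G1 x = g1 x"
    using lip[OF g1_deriv g2_bound[OF g1_bound]] by blast
  \<comment> \<open>Each estimate is transferred by shifting all arguments by \<open>e > 0\<close>,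
    where the versions for the open half-line apply, and letting \<open>e\<close> tend to
    zero.\<close>
  have cont_shift: "continuous_on {0..} (\<lambda>e. f (x + e))" if "continuous_on {0..} f" "0 \<le> x" for f :: "real \<Rightarrow> real" and x
    by (rule continuous_on_compose2[OF that(1)]) (use that(2) in \<open>auto intro!: continuous_intros\<close>)
  note shifts = cont_shift[OF G(1)] cont_shift[OF G1(1)] cont_shift[OF cont]
  show thesis
  proof (rule that[of G G1])
    fix x :: real assume x: "0 \<le> x"
    let ?d = "\<lambda>e. \<bar>real k / 2 * G (x + e) + (x + e) * G1 (x + e) - (x + e) / 2 * G (x + e) - (h (x + e) - ?c)\<bar>"
    have "?d 0 \<le> 0"
    proof (rule le_at_0_of_continuous)
      show "continuous_on {0..} ?d"
        by (intro continuous_intros shifts x) simp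
      show "?d e \<le> 0" if "0 < e" for e
      proof -
        have "0 < x + e" using x that by (rule add_nonneg_pos)
        then show ?thesis
          by (simp only: G(2) G1(2) stein_eq diff_self abs_zero order_refl)
      qed
    qed
    then show "real k / 2 * G x + x * G1 x - x / 2 * G x = h x - ?c" by simp
  next
    fix x :: real assume x: "0 \<le> x"
    have "\<bar>G1 (x + 0)\<bar> \<le> 16 * H1 / sqrt (real k + 2)"
      by (rule le_at_0_of_continuous)
         (use x G1(2) g1_bound in \<open>auto intro!: continuous_intros shifts\<close>)
    then show "\<bar>G1 x\<bar> \<le> 16 * H1 / sqrt (real k + 2)" by simp
  next
    fix H0 x :: real assume H0: "\<And>x. 0 \<le> x \<Longrightarrow> \<bar>h x\<bar> \<le> H0" and x: "0 \<le> x"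
    have "\<bar>h x - ?c\<bar> \<le> 2 * H0" if "0 < x" for x
      using H0[of x] abs_chi_square_expectation_le[OF k cont H0] that by auto
    note g1_bound_of_bounded[OF this]
    then have "\<bar>G1 (x + 0)\<bar> \<le> 4 * (H0 + H1) / (real k + 2)"
      by (intro le_at_0_of_continuous[of "\<lambda>e. \<bar>G1 (x + e)\<bar>"])
         (use x G1(2) in \<open>auto intro!: continuous_intros shifts\<close>)
    then show "\<bar>G1 x\<bar> \<le> 4 * (H0 + H1) / (real k + 2)" by simp
  next
    fix B x y :: real assume B: "\<And>x. 0 \<le> x \<Longrightarrow> \<bar>G1 x\<bar> \<le> B" and x: "0 \<le> x" and y: "0 \<le> y"
    have B': "\<bar>g1 x\<bar> \<le> B" if "0 < x" for x
      using B[of x] G1(2)[OF that] that by simp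
    have "\<bar>G (y + 0) - G (x + 0) - G1 (x + 0) * ((y + 0) - (x + 0))\<bar> \<le> (2 * H1 + H2 + B) / (real k + 4) * (y - x)\<^sup>2"
    proof (rule le_at_0_of_continuous)
      show "continuous_on {0..} (\<lambda>e. \<bar>G (y + e) - G (x + e) - G1 (x + e) * ((y + e) - (x + e))\<bar>)"
        by (intro continuous_intros shifts x y)
      show "\<bar>G (y + e) - G (x + e) - G1 (x + e) * ((y + e) - (x + e))\<bar> \<le> (2 * H1 + H2 + B) / (real k + 4) * (y - x)\<^sup>2"
        if "0 < e" for e
        using second_order_expansion[OF B', of "x + e" "y + e"] that x y by (simp add: G G1 add.commute)
    qed
    then show "\<bar>G y - G x - G1 x * (y - x)\<bar> \<le> (2 * H1 + H2 + B) / (real k + 4) * (y - x)\<^sup>2" by simp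
    have "\<bar>(real k / 2 * G (y + 0) + (y + 0) * G1 (y + 0)) - (real k / 2 * G (x + 0) + (x + 0) * G1 (x + 0))\<bar>
        \<le> ((real k + 2) / 2 * B + 4 * H1) * \<bar>y - x\<bar>"
    proof (rule le_at_0_of_continuous)
      show "continuous_on {0..} (\<lambda>e. \<bar>(real k / 2 * G (y + e) + (y + e) * G1 (y + e)) - (real k / 2 * G (x + e) + (x + e) * G1 (x + e))\<bar>)"
        by (intro continuous_intros shifts x y)
      show "\<bar>(real k / 2 * G (y + e) + (y + e) * G1 (y + e)) - (real k / 2 * G (x + e) + (x + e) * G1 (x + e))\<bar>
          \<le> ((real k + 2) / 2 * B + 4 * H1) * \<bar>y - x\<bar>" if "0 < e" for e
        using generator_lipschitz[OF B', of "x + e" "y + e"] that x y by (simp add: G G1)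
    qed
    then show "\<bar>(real k / 2 * G y + y * G1 y) - (real k / 2 * G x + x * G1 x)\<bar>
        \<le> ((real k + 2) / 2 * B + 4 * H1) * \<bar>y - x\<bar>" by simp
  qed
qed

section \<open>Pearson's statistic\<close>

text \<open>In the application \<open>q = 1 / sqrt (n p)\<close>, \<open>s\<close> is a standardized
  count, \<open>2 * (q * s) + b\<close> is the increment of the statistic caused by one trial and
  \<open>d\<close> that of \<open>g\<close>. Inserting the first-order value of \<open>d\<close>
  into \<open>(q * s + b) * d\<close> produces the term \<open>2 * g1 * (q * s)\<^sup>2\<close>;
  what remains after subtracting it has order at least three in \<open>q\<close>, hence order
  \<open>q\<close> after division by \<open>q\<^sup>2\<close>.\<close>

lemma stein_residual_bound:
  fixes q s b :: real
  assumes q: "0 < q" and b: "0 \<le> b" "b \<le> q\<^sup>2" and g1: "\<bar>g1\<bar> \<le> B"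
    and d: "\<bar>d - g1 * (2 * (q * s) + b)\<bar> \<le> D * (2 * (q * s) + b)\<^sup>2" and D: "0 \<le> D"
  shows "\<bar>(1 / q\<^sup>2) * ((q * s + b) * d - 2 * g1 * (q * s)\<^sup>2)\<bar>
    \<le> B * q * (3 * \<bar>s\<bar> + q) + D * q * (4 * \<bar>s\<bar> ^ 3 + 8 * s\<^sup>2 * q + 5 * \<bar>s\<bar> * q\<^sup>2 + q ^ 3)"
proof -
  let ?y = "q * s"
  have B: "0 \<le> B" using g1 by linarith
  have y: "\<bar>?y\<bar> = q * \<bar>s\<bar>" using q by (simp add: abs_mult)
  have "(?y + b) * d - 2 * g1 * ?y\<^sup>2 = g1 * (3 * ?y * b + b\<^sup>2) + (d - g1 * (2 * ?y + b)) * (?y + b)"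
    by (simp add: algebra_simps power2_eq_square)
  also have "\<bar>\<dots>\<bar> \<le> \<bar>g1\<bar> * \<bar>3 * ?y * b + b\<^sup>2\<bar> + \<bar>d - g1 * (2 * ?y + b)\<bar> * \<bar>?y + b\<bar>"
    by (metis abs_mult abs_triangle_ineq)
  also have "\<dots> \<le> B * (3 * (q * \<bar>s\<bar>) * q\<^sup>2 + (q\<^sup>2)\<^sup>2) + D * (2 * (q * \<bar>s\<bar>) + q\<^sup>2)\<^sup>2 * (q * \<bar>s\<bar> + q\<^sup>2)"
  proof (intro add_mono mult_mono)
    have "\<bar>3 * ?y * b\<bar> \<le> 3 * (q * \<bar>s\<bar>) * q\<^sup>2"
      using b q unfolding abs_mult by (intro mult_mono) auto
    moreover have "\<bar>b\<^sup>2\<bar> \<le> (q\<^sup>2)\<^sup>2" using power_mono[OF b(2,1), of 2] by simp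
    ultimately show "\<bar>3 * ?y * b + b\<^sup>2\<bar> \<le> 3 * (q * \<bar>s\<bar>) * q\<^sup>2 + (q\<^sup>2)\<^sup>2" by linarith
    have "\<bar>2 * ?y + b\<bar> \<le> 2 * (q * \<bar>s\<bar>) + q\<^sup>2" using b y by linarith
    then have "\<bar>2 * ?y + b\<bar>\<^sup>2 \<le> (2 * (q * \<bar>s\<bar>) + q\<^sup>2)\<^sup>2" by (intro power_mono) auto
    then show "\<bar>d - g1 * (2 * ?y + b)\<bar> \<le> D * (2 * (q * \<bar>s\<bar>) + q\<^sup>2)\<^sup>2"
      using mult_left_mono[OF _ D] d by fastforce
    show "\<bar>?y + b\<bar> \<le> q * \<bar>s\<bar> + q\<^sup>2" using b y by linarith
  qed (use g1 B D in auto)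
  also have "\<dots> = q\<^sup>2 * (B * q * (3 * \<bar>s\<bar> + q) + D * q * (4 * \<bar>s\<bar> ^ 3 + 8 * \<bar>s\<bar>\<^sup>2 * q + 5 * \<bar>s\<bar> * q\<^sup>2 + q ^ 3))"
    by algebra
  finally show ?thesis
    using q by (simp add: abs_mult field_simps)
qed

context class_probabilities
begin

text \<open>The counts are centred for \<open>n'\<close> trials but normalized for \<open>n\<close>, so that \<open>n' = n - 1\<close> gives the
  statistic with one trial left out.\<close>

definition pearson :: "nat \<Rightarrow> nat \<Rightarrow> (nat \<Rightarrow> nat) \<Rightarrow> real" where
  "pearson n n' u = (\<Sum>j=1..r. (real (u j) - real n' * p j)\<^sup>2 / (real n * p j))"

lemma pearson_nonneg: "0 \<le> pearson n n' u"
  unfolding pearson_def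
proof (rule sum_nonneg)
  fix j assume "j \<in> {1..r}"
  from p_pos[OF this] show "0 \<le> (real (u j) - real n' * p j)\<^sup>2 / (real n * p j)" by simp
qed

lemma sum_centered:
  assumes "(\<Sum>j=1..r. u j) = n"
  shows "(\<Sum>j=1..r. real (u j) - real n * p j) = 0"
  using assms sum_p by (simp add: sum_subtractf flip: sum_distrib_left of_nat_sum)

text \<open>Expand the squares. The cross terms \<open>- 2 * a j / N\<close> cancel because centred
  counts sum to zero, and the terms \<open>p j / N\<close> sum to \<open>1 / N\<close>, which turns
  the numerator \<open>1 - 2 * p k\<close> into \<open>1 - p k\<close>.\<close>

lemma pearson_add_trial:
  assumes v: "(\<Sum>j=1..r. v j) = n" and k: "k \<in> {1..r}" and N: "N = Suc n"
  shows "pearson N N (v(k := Suc (v k)))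
    = pearson N n v + (2 * ((real (v k) - real n * p k) / (real N * p k)) + (1 - p k) / (real N * p k))"
proof -
  define a where "a j = real (v j) - real n * p j" for j
  have "pearson N N (v(k := Suc (v k))) = (\<Sum>j=1..r. (a j + (of_bool (j = k) - p j))\<^sup>2 / (real N * p j))"
    unfolding pearson_def a_def N
    by (intro sum.cong refl arg_cong2[where f = "(/)"] arg_cong[where f = "\<lambda>x. x\<^sup>2"]) (auto simp: algebra_simps)
  also have "\<dots> = (\<Sum>j=1..r. (a j)\<^sup>2 / (real N * p j)
      + of_bool (j = k) * (2 * a k / (real N * p k) + (1 - 2 * p k) / (real N * p k))
      + (p j - 2 * a j) / real N)"
  proof (rule sum.cong[OF refl])
    fix j assume "j \<in> {1..r}"
    then have "0 < p j" by (rule p_pos)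
    then show "(a j + (of_bool (j = k) - p j))\<^sup>2 / (real N * p j) = (a j)\<^sup>2 / (real N * p j)
      + of_bool (j = k) * (2 * a k / (real N * p k) + (1 - 2 * p k) / (real N * p k))
      + (p j - 2 * a j) / real N"
    proof -
      have "(A + (1 - P))\<^sup>2 / (R * P) = A\<^sup>2 / (R * P) + (2 * A / (R * P) + (1 - 2 * P) / (R * P)) + (P - 2 * A) / R"
        "(A + (0 - P))\<^sup>2 / (R * P) = A\<^sup>2 / (R * P) + (P - 2 * A) / R" if "0 < P" "0 < R" for A P R :: real
        using that by (simp_all add: field_simps power2_eq_square)
      from this[OF \<open>0 < p j\<close>, of "real N" "a j"] N show ?thesis by (cases "j = k") simp_all
    qed
  qed
  also have "\<dots> = pearson N n v + (2 * a k / (real N * p k) + (1 - 2 * p k) / (real N * p k))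
      + (\<Sum>j=1..r. p j - 2 * a j) / real N"
    using k by (simp add: sum.distrib pearson_def a_def sum_divide_distrib)
  also have "(\<Sum>j=1..r. p j - 2 * a j) = 1"
    using sum_centered[OF v] sum_p by (simp add: sum_subtractf a_def flip: sum_distrib_left)
  also have "2 * a k / (real N * p k) + (1 - 2 * p k) / (real N * p k)
      = 2 * (a k / (real N * p k)) + (1 - p k) / (real N * p k) - 1 / real N"
    using p_pos[OF k] N by (simp add: diff_divide_distrib)
  finally show ?thesis
    by (simp add: a_def fun_upd_def)
qed

text \<open>As centred counts sum to zero, one factor of each square may be replaced by
  \<open>u j\<close>, which is the form that size biasing requires.\<close>

lemma pearson_eq_size_biased:
  assumes u: "(\<Sum>j=1..r. u j) = n" and n: "0 < n"
  shows "pearson n n u = (\<Sum>j=1..r. real (u j) * (real (u j) - real n * p j) / (real n * p j))"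
proof -
  have "(\<Sum>j=1..r. real (u j) * (real (u j) - real n * p j) / (real n * p j))
      = (\<Sum>j=1..r. (real (u j) - real n * p j)\<^sup>2 / (real n * p j) + (real (u j) - real n * p j))"
    by (intro sum.cong refl) (use p_pos n in \<open>force simp: field_simps power2_eq_square\<close>)
  then show ?thesis
    using sum_centered[OF u] by (simp add: sum.distrib pearson_def)
qed

text \<open>Chebyshev's sum inequality: \<open>p j\<close> and \<open>1 / sqrt (n * p j)\<close> are
  oppositely ordered. The factor \<open>1 / r\<close> later compensates the growth of the Lipschitz
  constant \<open>L\<close> with \<open>r\<close>.\<close>

lemma sum_weighted_inverse_sqrt_le:
  assumes n: "0 < n"
  shows "(\<Sum>j=1..r. p j * (1 / sqrt (real n * p j))) \<le> (\<Sum>j=1..r. 1 / sqrt (real n * p j)) / real r"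
proof -
  define q where "q = (\<lambda>j. 1 / sqrt (real n * p j))"
  have "0 \<le> (\<Sum>i=1..r. \<Sum>j=1..r. (p i - p j) * (q j - q i))"
  proof (intro sum_nonneg)
    fix i j assume ij: "i \<in> {1..r}" "j \<in> {1..r}"
    show "0 \<le> (p i - p j) * (q j - q i)"
    proof (cases "p i \<le> p j")
      case True
      then have "q j \<le> q i" using p_pos[OF ij(1)] n unfolding q_def by (intro divide_left_mono) auto
      with True show ?thesis by (intro mult_nonpos_nonpos) auto
    next
      case False
      then have "q i \<le> q j" using p_pos[OF ij(2)] n unfolding q_def by (intro divide_left_mono) auto
      with False show ?thesis by (intro mult_nonneg_nonneg) auto
    qed
  qed
  also have "\<dots> = (\<Sum>i=1..r. \<Sum>j=1..r. p i * q j) - (\<Sum>i=1..r. \<Sum>j=1..r. p i * q i)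
      - (\<Sum>i=1..r. \<Sum>j=1..r. p j * q j) + (\<Sum>i=1..r. \<Sum>j=1..r. p j * q i)"
    by (simp add: algebra_simps sum.distrib sum_subtractf)
  also have "\<dots> = 2 * (\<Sum>j=1..r. q j) - 2 * (real r * (\<Sum>j=1..r. p j * q j))"
    using sum_p by (simp flip: sum_distrib_left sum_distrib_right)
  finally have "(\<Sum>j=1..r. p j * q j) \<le> (\<Sum>j=1..r. q j) / real r"
    using r_pos by (simp add: field_simps)
  then show ?thesis by (simp only: q_def)
qed

text \<open>Size biasing writes the error as an expectation over \<open>n - 1\<close> trials, summed
  over the class \<open>k\<close> to which the removed trial is returned. Passing from the full
  statistic to the one without this trial costs a Lipschitz error for \<open>G\<close> and a Taylor
  error for \<open>g\<close>.\<close>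

lemma pearson_stein_bound:
  fixes g g1 :: "real \<Rightarrow> real" and n :: nat
  assumes np: "\<And>j. j \<in> {1..r} \<Longrightarrow> 2 \<le> real n * p j"
    and B: "\<And>x. 0 \<le> x \<Longrightarrow> \<bar>g1 x\<bar> \<le> B"
    and D: "\<And>x y. 0 \<le> x \<Longrightarrow> 0 \<le> y \<Longrightarrow> \<bar>g y - g x - g1 x * (y - x)\<bar> \<le> D * (y - x)\<^sup>2" "0 \<le> D"
    and L: "\<And>x y. 0 \<le> x \<Longrightarrow> 0 \<le> y \<Longrightarrow> \<bar>G y - G x\<bar> \<le> L * \<bar>y - x\<bar>" "0 \<le> L"
    and G: "\<And>x. G x = (real r - 1) / 2 * g x + x * g1 x"
  shows "\<bar>E n (\<lambda>u. G (pearson n n u) - pearson n n u / 2 * g (pearson n n u))\<bar>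
    \<le> (1.86 * B + 8.1 * D + 2.72 / real r * L) * (\<Sum>j=1..r. 1 / sqrt (real n * p j))"
proof -
  have n: "0 < n" using np[of 1] r_pos by (cases n) auto
  then obtain n' where n': "n = Suc n'" by (cases n) auto
  define q where "q j = 1 / sqrt (real n * p j)" for j
  define s where "s j v = (real (v j) - real n' * p j) / sqrt (real n * p j)" for j and v :: "nat \<Rightarrow> nat"
  define b where "b j = (1 - p j) / (real n * p j)" for j
  have pj: "0 < p j" "p j \<le> 1" if "j \<in> {1..r}" for j
    using p_pos p_le_1 that by auto
  have q2: "(q j)\<^sup>2 = 1 / (real n * p j)" and q0: "0 < q j" if "j \<in> {1..r}" for j
    using pj[OF that] n by (auto simp: q_def power_divide)
  \<comment> \<open>\<open>5 / 7\<close> is a rational upper bound of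
    \<open>1 / sqrt 2\<close>.\<close>
  have q_le: "q j \<le> 5 / 7" if "j \<in> {1..r}" for j
  proof (rule power2_le_imp_le)
    have "(q j)\<^sup>2 \<le> 1 / 2" unfolding q2[OF that] using np[OF that] by (intro divide_left_mono) auto
    then show "(q j)\<^sup>2 \<le> (5 / 7)\<^sup>2" by (simp add: power_divide)
  qed simp
  have y: "q j * s j v = (real (v j) - real n' * p j) / (real n * p j)" if "j \<in> {1..r}" for j v
    using pj[OF that] n by (simp add: q_def s_def)
  have b: "0 \<le> b j" "b j \<le> (q j)\<^sup>2" if "j \<in> {1..r}" for j
    using pj[OF that] n unfolding q2[OF that] by (auto simp: b_def intro!: divide_right_mono)
  let ?W = "\<lambda>k v. pearson n n (v(k := Suc (v k)))"
  let ?w = "pearson n n'"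
  \<comment> \<open>\<open>real (v k) + 1\<close> is the count once the removed trial is put back
    into class \<open>k\<close>.\<close>
  let ?T = "\<lambda>k v. p k * G (?W k v) - (real (v k) + 1 - real n * p k) / 2 * g (?W k v)"
  let ?R = "\<lambda>k s. L * (p k * q k) * (2 * \<bar>s\<bar> + q k) + (B * q k * (3 * \<bar>s\<bar> + q k)
      + D * q k * (4 * \<bar>s\<bar> ^ 3 + 8 * s\<^sup>2 * q k + 5 * \<bar>s\<bar> * (q k)\<^sup>2 + q k ^ 3)) / 2"
  have "E n (\<lambda>u. pearson n n u / 2 * g (pearson n n u))
      = E n (\<lambda>u. \<Sum>k=1..r. 1 / (real n * p k) * (real (u k) * ((real (u k) - real n * p k) / 2 * g (pearson n n u))))"
  proof (rule E_cong)
    fix u assume u: "(\<Sum>j=1..r. u j) = n"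
    show "pearson n n u / 2 * g (pearson n n u) = (\<Sum>k=1..r. 1 / (real n * p k) * (real (u k) * ((real (u k) - real n * p k) / 2 * g (pearson n n u))))"
      by (subst pearson_eq_size_biased[OF u n], simp only: sum_divide_distrib sum_distrib_right,
          intro sum.cong refl) (simp add: mult_ac)
  qed
  also have "\<dots> = (\<Sum>k=1..r. 1 / (real n * p k) * (real n * p k * E n' (\<lambda>v. (real (v k) + 1 - real n * p k) / 2 * g (?W k v))))"
    unfolding E_sum[OF finite_atLeastAtMost] E_cmult
  proof (intro sum.cong refl arg_cong2[where f = "(*)"])
    fix k assume k: "k \<in> {1..r}"
    show "E n (\<lambda>v. real (v k) * ((real (v k) - real n * p k) / 2 * g (pearson n n v)))
        = real n * p k * E n' (\<lambda>v. (real (v k) + 1 - real n * p k) / 2 * g (?W k v))"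
      unfolding n' E_size_bias[OF k] by (simp add: algebra_simps)
  qed
  also have "\<dots> = (\<Sum>k=1..r. E n' (\<lambda>v. (real (v k) + 1 - real n * p k) / 2 * g (?W k v)))"
    using n by (intro sum.cong refl) (use pj in force)
  finally have eq: "E n (\<lambda>u. G (pearson n n u) - pearson n n u / 2 * g (pearson n n u)) = E n' (\<lambda>v. \<Sum>k=1..r. ?T k v)"
    unfolding E_diff E_sum[OF finite_atLeastAtMost] E_cmult sum_subtractf by (simp add: n')
  have "\<bar>E n (\<lambda>u. G (pearson n n u) - pearson n n u / 2 * g (pearson n n u))\<bar> \<le> E n' (\<lambda>v. \<bar>\<Sum>k=1..r. ?T k v\<bar>)"
    unfolding eq by (rule abs_E_le)
  also have "\<dots> \<le> E n' (\<lambda>v. \<Sum>k=1..r. ?R k (s k v))"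
  proof (rule E_mono)
    fix v assume v: "(\<Sum>j=1..r. v j) = n'"
    define d where "d k = g (?W k v) - g (?w v)" for k
    define y where "y k = q k * s k v" for k
    have yk: "real (v k) - real n' * p k = real n * p k * y k" if "k \<in> {1..r}" for k
      using y[OF that, of v] pj[OF that] n by (simp add: y_def)
    have W: "?W k v = ?w v + (2 * y k + b k)" if "k \<in> {1..r}" for k
      unfolding y_def y[OF that] b_def by (rule pearson_add_trial[OF v that n'])
    have center: "(\<Sum>k=1..r. real n * p k * y k) = 0"
      using sum_centered[OF v] yk by simp
    have bsum: "(\<Sum>k=1..r. real n * p k * b k) = real r - 1"
    proof -
      have "(\<Sum>k=1..r. real n * p k * b k) = (\<Sum>k=1..r. 1 - p k)"
        using n by (intro sum.cong refl) (use pj in \<open>force simp: b_def\<close>)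
      then show ?thesis using sum_p by (simp add: sum_subtractf)
    qed
    have ysum: "(\<Sum>k=1..r. real n * p k * (y k)\<^sup>2) = ?w v"
      unfolding pearson_def
    proof (rule sum.cong[OF refl])
      fix k assume "k \<in> {1..r}"
      then show "real n * p k * (y k)\<^sup>2 = (real (v k) - real n' * p k)\<^sup>2 / (real n * p k)"
        using yk[of k] pj[of k] n by (simp add: power2_eq_square)
    qed
    \<comment> \<open>Centring kills the terms linear in \<open>y\<close>, the \<open>b\<close>
      terms sum to \<open>r - 1\<close> and the squares to \<open>?w v\<close>; so the first-order
      expansion of \<open>g\<close> reproduces \<open>G (?w v)\<close> exactly.\<close>
    have "G (?w v) = (\<Sum>k=1..r. real n * p k * ((y k + b k) / 2 * g (?w v) + g1 (?w v) * (y k)\<^sup>2))"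
    proof -
      have "(\<Sum>k=1..r. real n * p k * ((y k + b k) / 2 * g (?w v) + g1 (?w v) * (y k)\<^sup>2))
          = (\<Sum>k=1..r. (real n * p k * y k) * (g (?w v) / 2) + (real n * p k * b k) * (g (?w v) / 2) + (real n * p k * (y k)\<^sup>2) * g1 (?w v))"
        by (intro sum.cong refl) (simp add: algebra_simps add_divide_distrib)
      also have "\<dots> = G (?w v)"
        unfolding sum.distrib sum_distrib_right[symmetric] center bsum ysum G by simp
      finally show ?thesis ..
    qed
    moreover have "G (?w v) = (\<Sum>k=1..r. p k * G (?w v))"
      using sum_p by (simp flip: sum_distrib_right)
    \<comment> \<open>\<open>G (?w v)\<close> is subtracted as a \<open>p\<close>-weighted sum and
      added back in its expanded form, so that both comparisons are made class by class.\<close>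
    ultimately have "(\<Sum>k=1..r. ?T k v) = (\<Sum>k=1..r. ?T k v) - (\<Sum>k=1..r. p k * G (?w v))
        + (\<Sum>k=1..r. real n * p k * ((y k + b k) / 2 * g (?w v) + g1 (?w v) * (y k)\<^sup>2))" by linarith
    also have "\<dots> = (\<Sum>k=1..r. ?T k v - p k * G (?w v) + real n * p k * ((y k + b k) / 2 * g (?w v) + g1 (?w v) * (y k)\<^sup>2))"
      by (simp add: sum.distrib sum_subtractf)
    also have "\<dots> = (\<Sum>k=1..r. p k * (G (?W k v) - G (?w v))
        - 1 / (q k)\<^sup>2 * ((y k + b k) * d k - 2 * g1 (?w v) * (y k)\<^sup>2) / 2)"
    proof (rule sum.cong[OF refl])
      fix k assume k: "k \<in> {1..r}"
      have "real (v k) + 1 - real n * p k = (real (v k) - real n' * p k) + (1 - p k)"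
        by (simp add: n' algebra_simps)
      also have "\<dots> = real n * p k * (y k + b k)"
        unfolding yk[OF k] using pj[OF k] n by (simp add: b_def distrib_left)
      finally have *: "real (v k) + 1 - real n * p k = real n * p k * (y k + b k)" .
      have **: "1 / (q k)\<^sup>2 = real n * p k" using q2[OF k] by simp
      show "?T k v - p k * G (?w v) + real n * p k * ((y k + b k) / 2 * g (?w v) + g1 (?w v) * (y k)\<^sup>2)
          = p k * (G (?W k v) - G (?w v)) - 1 / (q k)\<^sup>2 * ((y k + b k) * d k - 2 * g1 (?w v) * (y k)\<^sup>2) / 2"
        unfolding * ** d_def by (simp add: field_simps)
    qed
    finally have Teq: "(\<Sum>k=1..r. ?T k v) = (\<Sum>k=1..r. p k * (G (?W k v) - G (?w v))
        - 1 / (q k)\<^sup>2 * ((y k + b k) * d k - 2 * g1 (?w v) * (y k)\<^sup>2) / 2)" .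
    show "\<bar>\<Sum>k=1..r. ?T k v\<bar> \<le> (\<Sum>k=1..r. ?R k (s k v))"
      unfolding Teq
    proof (rule order_trans[OF sum_abs sum_mono])
      fix k assume k: "k \<in> {1..r}"
      have "\<bar>1 / (q k)\<^sup>2 * ((y k + b k) * d k - 2 * g1 (?w v) * (y k)\<^sup>2)\<bar>
          \<le> B * q k * (3 * \<bar>s k v\<bar> + q k) + D * q k * (4 * \<bar>s k v\<bar> ^ 3 + 8 * (s k v)\<^sup>2 * q k + 5 * \<bar>s k v\<bar> * (q k)\<^sup>2 + q k ^ 3)"
        unfolding y_def
      proof (rule stein_residual_bound[OF q0[OF k] b[OF k] _ _ D(2)])
        show "\<bar>g1 (?w v)\<bar> \<le> B" by (intro B pearson_nonneg)
        show "\<bar>d k - g1 (?w v) * (2 * (q k * s k v) + b k)\<bar> \<le> D * (2 * (q k * s k v) + b k)\<^sup>2"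
          using D(1)[OF pearson_nonneg pearson_nonneg, of n n "v(k := Suc (v k))" n n' v] W[OF k] by (simp add: d_def y_def)
      qed
      moreover have "\<bar>p k * (G (?W k v) - G (?w v))\<bar> \<le> L * (p k * q k) * (2 * \<bar>s k v\<bar> + q k)"
      proof -
        have "\<bar>2 * y k + b k\<bar> \<le> 2 * (q k * \<bar>s k v\<bar>) + (q k)\<^sup>2"
          using b[OF k] q0[OF k] abs_triangle_ineq[of "2 * y k" "b k"] by (simp add: y_def abs_mult)
        also have "\<dots> = q k * (2 * \<bar>s k v\<bar> + q k)" by (simp add: algebra_simps power2_eq_square)
        finally have "L * \<bar>?W k v - ?w v\<bar> \<le> L * (q k * (2 * \<bar>s k v\<bar> + q k))"
          unfolding W[OF k] using L(2) by (intro mult_left_mono) auto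
        then have "\<bar>G (?W k v) - G (?w v)\<bar> \<le> L * (q k * (2 * \<bar>s k v\<bar> + q k))"
          using L(1)[OF pearson_nonneg pearson_nonneg, of n n "v(k := Suc (v k))" n n' v] by linarith
        then have "p k * \<bar>G (?W k v) - G (?w v)\<bar> \<le> p k * (L * (q k * (2 * \<bar>s k v\<bar> + q k)))"
          using pj[OF k] by (intro mult_left_mono) auto
        then show ?thesis using pj[OF k] by (simp add: abs_mult mult_ac)
      qed
      moreover have abs_sub_half_le: "\<bar>a\<bar> \<le> x \<Longrightarrow> \<bar>b\<bar> \<le> y \<Longrightarrow> \<bar>a - b / 2\<bar> \<le> x + y / 2" for a b x y :: real
        by (auto simp: abs_le_iff field_simps)
      ultimately show "\<bar>p k * (G (?W k v) - G (?w v)) - 1 / (q k)\<^sup>2 * ((y k + b k) * d k - 2 * g1 (?w v) * (y k)\<^sup>2) / 2\<bar> \<le> ?R k (s k v)"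
        using abs_sub_half_le by blast
    qed
  qed
  also have "\<dots> = (\<Sum>k=1..r. E n' (\<lambda>v. ?R k (s k v)))"
    by (simp add: E_sum)
  \<comment> \<open>With \<open>q k \<le> 5/7\<close> and the moment bounds:
    \<open>2 + 5/7 \<le> 2.72\<close>, \<open>3/2 + 5/14 \<le> 1.86\<close>, and the coefficients of
    \<open>D\<close> sum to at most \<open>8.1\<close>.\<close>
  also have "\<dots> \<le> (\<Sum>k=1..r. 2.72 * L * (p k * q k) + (1.86 * B + 8.1 * D) * q k)"
  proof (rule sum_mono)
    fix k assume k: "k \<in> {1..r}"
    note mom = E_standardized_moments[OF k _ np[OF k], of n', folded s_def]
    have qk: "0 < q k" "q k \<le> 5 / 7" using q0 q_le k by auto
    have B0: "0 \<le> B" using B[of 0] by simp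
    have "E n' (\<lambda>v. ?R k (s k v)) = E n' (\<lambda>v. (2 * L * (p k * q k) + 3 / 2 * B * q k + 5 / 2 * D * q k * (q k)\<^sup>2) * \<bar>s k v\<bar>
        + 2 * D * q k * \<bar>s k v\<bar> ^ 3 + 4 * D * q k * q k * (s k v)\<^sup>2
        + (L * (p k * q k) * q k + B / 2 * q k * q k + D / 2 * q k * q k ^ 3))"
      by (intro arg_cong[where f = "E n'"] ext) (simp add: field_simps)
    also have "\<dots> = (2 * L * (p k * q k) + 3 / 2 * B * q k + 5 / 2 * D * q k * (q k)\<^sup>2) * E n' (\<lambda>v. \<bar>s k v\<bar>)
        + 2 * D * q k * E n' (\<lambda>v. \<bar>s k v\<bar> ^ 3) + 4 * D * q k * q k * E n' (\<lambda>v. (s k v)\<^sup>2)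
        + (L * (p k * q k) * q k + B / 2 * q k * q k + D / 2 * q k * q k ^ 3)"
      unfolding E_add E_cmult E_const ..
    also have "\<dots> \<le> (2 * L * (p k * q k) + 3 / 2 * B * q k + 5 / 2 * D * q k * (5/7)\<^sup>2) * 1
        + 2 * D * q k * (15 / 8) + 4 * D * q k * (5/7) * 1
        + (L * (p k * q k) * (5/7) + B / 2 * q k * (5/7) + D / 2 * q k * (5/7) ^ 3)"
    proof -
      have le1: "E n' (\<lambda>v. \<bar>s k v\<bar>) \<le> 1" "E n' (\<lambda>v. \<bar>s k v\<bar> ^ 3) \<le> 15 / 8" "E n' (\<lambda>v. (s k v)\<^sup>2) \<le> 1"
        using mom n' by auto
      have nonneg: "0 \<le> E n' (\<lambda>v. \<bar>s k v\<bar>)" "0 \<le> E n' (\<lambda>v. \<bar>s k v\<bar> ^ 3)" "0 \<le> E n' (\<lambda>v. (s k v)\<^sup>2)"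
        using E_mono[of n' "\<lambda>_. 0"] by (auto simp: E_const)
      show ?thesis
        using le1 nonneg qk B0 D(2) L(2) pj[OF k]
        by (intro add_mono mult_mono power_mono add_nonneg_nonneg mult_nonneg_nonneg) auto
    qed
    also have "\<dots> \<le> 2.72 * L * (p k * q k) + (1.86 * B + 8.1 * D) * q k"
    proof -
      have "0 \<le> L * (p k * q k)" "0 \<le> B * q k" "0 \<le> D * q k"
        using qk B0 D(2) L(2) pj[OF k] by auto
      then show ?thesis by (simp add: power2_eq_square power3_eq_cube algebra_simps)
    qed
    finally show "E n' (\<lambda>v. ?R k (s k v)) \<le> 2.72 * L * (p k * q k) + (1.86 * B + 8.1 * D) * q k" .
  qed
  also have "\<dots> = 2.72 * L * (\<Sum>k=1..r. p k * q k) + (1.86 * B + 8.1 * D) * (\<Sum>k=1..r. q k)"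
    by (simp add: sum.distrib sum_distrib_left)
  also have "\<dots> \<le> 2.72 * L * ((\<Sum>k=1..r. q k) / real r) + (1.86 * B + 8.1 * D) * (\<Sum>k=1..r. q k)"
    using sum_weighted_inverse_sqrt_le[OF n] L(2) unfolding q_def[abs_def] by (intro add_mono mult_left_mono order_refl) auto
  also have "\<dots> = (1.86 * B + 8.1 * D + 2.72 / real r * L) * (\<Sum>k=1..r. q k)"
    by (simp add: algebra_simps)
  finally show ?thesis by (simp add: q_def)
qed

end

section \<open>Comparison of the power divergence statistic with Pearson's statistic\<close>

definition box_cox :: "real \<Rightarrow> real \<Rightarrow> real" where
  "box_cox l x = (if l = 0 then ln x else (x powr l - 1) / l)"

text \<open>The linear term \<open>x - 1\<close> contributes nothing to the statistic, since centred
  counts sum to zero, but makes the function vanish to second order at \<open>1\<close>.\<close>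

definition divergence_term :: "real \<Rightarrow> real \<Rightarrow> real" where
  "divergence_term l x = 2 / (l + 1) * (x * box_cox l x - (x - 1))"

lemma box_cox_1 [simp]: "box_cox l 1 = 0"
  by (simp add: box_cox_def)

lemma divergence_term_0: "divergence_term l 0 = 2 / (l + 1)"
  by (simp add: divergence_term_def)

lemma box_cox_deriv:
  assumes "0 < x"
  shows "(box_cox l has_real_derivative x powr (l - 1)) (at x)"
proof (cases "l = 0")
  case True
  then show ?thesis
    using assms DERIV_ln[OF assms] by (simp add: box_cox_def[abs_def] powr_minus)
next
  case False
  have "((\<lambda>x. (x powr l - 1) / l) has_real_derivative l * x powr (l - 1) / l) (at x)"
    by (rule DERIV_cdivide, rule DERIV_cong[OF DERIV_diff[OF has_real_derivative_powr[OF assms] DERIV_const]]) simp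
  then show ?thesis using False by (simp add: box_cox_def[abs_def])
qed

text \<open>\<open>x powr l = l * box_cox l x + 1\<close> lets the factor \<open>l + 1\<close>
  cancel, with \<open>l = 0\<close> included.\<close>

lemma divergence_term_deriv:
  assumes x: "0 < x" and l: "-1 < l"
  shows "(divergence_term l has_real_derivative 2 * box_cox l x) (at x)"
proof -
  have "(divergence_term l has_real_derivative 2 / (l + 1) * (1 * box_cox l x + x powr (l - 1) * x - (1 - 0))) (at x)"
    unfolding divergence_term_def
    by (intro DERIV_cmult DERIV_diff DERIV_mult DERIV_ident DERIV_const box_cox_deriv x)
  moreover have "x powr (l - 1) * x = x powr l"
    using x by (simp add: powr_diff)
  moreover have "x powr l = l * box_cox l x + 1"
    using x by (simp add: box_cox_def)
  ultimately have "(divergence_term l has_real_derivative 2 / (l + 1) * (1 * box_cox l x + (l * box_cox l x + 1) - (1 - 0))) (at x)"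
    by simp
  moreover have "2 / (l + 1) * (1 * box_cox l x + (l * box_cox l x + 1) - (1 - 0)) = 2 * box_cox l x"
    using l by (simp add: field_simps)
  ultimately show ?thesis by (simp only:)
qed

lemma taylor_about_1:
  fixes diff :: "nat \<Rightarrow> real \<Rightarrow> real"
  assumes x: "0 < x" and n: "0 < n"
    and deriv: "\<And>i t. i < n \<Longrightarrow> 0 < t \<Longrightarrow> (diff i has_real_derivative diff (Suc i) t) (at t)"
    and zero: "\<And>i. i < n \<Longrightarrow> diff i 1 = 0"
  shows "\<exists>t>0. diff 0 x = diff n t / fact n * (x - 1) ^ n \<and> (x \<le> t \<and> t \<le> 1 \<or> 1 \<le> t \<and> t \<le> x)"
proof (cases "x = 1")
  case True
  then show ?thesis using zero[of 0] n by (intro exI[of _ 1]) simp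
next
  case False
  have "\<exists>t. (if x < 1 then x < t \<and> t < 1 else 1 < t \<and> t < x) \<and>
      diff 0 x = (\<Sum>i<n. diff i 1 / fact i * (x - 1) ^ i) + diff n t / fact n * (x - 1) ^ n"
    using x n False deriv by (intro Taylor[where a = "min x 1" and b = "max x 1"]) auto
  then obtain t where t: "if x < 1 then x < t \<and> t < 1 else 1 < t \<and> t < x"
    and eq: "diff 0 x = (\<Sum>i<n. diff i 1 / fact i * (x - 1) ^ i) + diff n t / fact n * (x - 1) ^ n"
    by blast
  have "(\<Sum>i<n. diff i 1 / fact i * (x - 1) ^ i) = 0"
    using zero by (intro sum.neutral) auto
  then show ?thesis
    using t eq x by (intro exI[of _ t]) (auto split: if_splits)
qed

text \<open>\<open>1\<close> is a double zero and the second derivative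
  \<open>2 * x powr (l - 1)\<close> is positive. Nonnegativity places the statistic in the half-line
  on which \<open>h\<close> is controlled.\<close>

lemma divergence_term_nonneg:
  assumes x: "0 \<le> x" and l: "-1 < l"
  shows "0 \<le> divergence_term l x"
proof (cases "x = 0")
  case False
  define diff where "diff i = (if i = 0 then divergence_term l else if i = 1 then (\<lambda>x. 2 * box_cox l x) else (\<lambda>x. 2 * x powr (l - 1)))" for i :: nat
  have "\<exists>t>0. diff 0 x = diff 2 t / fact 2 * (x - 1) ^ 2 \<and> (x \<le> t \<and> t \<le> 1 \<or> 1 \<le> t \<and> t \<le> x)"
  proof (rule taylor_about_1)
    show "(diff i has_real_derivative diff (Suc i) t) (at t)" if "i < 2" "0 < t" for i t
      using divergence_term_deriv[OF that(2) l] DERIV_cmult[OF box_cox_deriv[OF that(2)]] that(1)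
      by (auto simp: diff_def less_2_cases_iff)
    show "diff i 1 = 0" if "i < 2" for i
      using that by (auto simp: diff_def less_2_cases_iff divergence_term_def)
  qed (use x False in auto)
  then show ?thesis by (auto simp: diff_def)
qed (use l in \<open>simp add: divergence_term_0\<close>)

lemma divergence_term_third_order:
  assumes x: "0 < x" and l: "-1 < l"
  shows "\<exists>t>0. divergence_term l x - (x - 1)\<^sup>2 = (l - 1) / 3 * t powr (l - 2) * (x - 1) ^ 3 \<and>
    (x \<le> t \<and> t \<le> 1 \<or> 1 \<le> t \<and> t \<le> x)"
proof -
  define diff where "diff i = (if i = 0 then \<lambda>x. divergence_term l x - (x - 1)\<^sup>2 else if i = 1 then \<lambda>x. 2 * box_cox l x - 2 * (x - 1)
    else if i = 2 then \<lambda>x. 2 * x powr (l - 1) - 2 else (\<lambda>x. 2 * ((l - 1) * x powr (l - 2))))" for i :: nat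
  have "\<exists>t>0. diff 0 x = diff 3 t / fact 3 * (x - 1) ^ 3 \<and> (x \<le> t \<and> t \<le> 1 \<or> 1 \<le> t \<and> t \<le> x)"
  proof (rule taylor_about_1[OF x])
    fix i :: nat and t :: real assume i: "i < 3" and t: "0 < t"
    have "((\<lambda>x. divergence_term l x - (x - 1)\<^sup>2) has_real_derivative 2 * box_cox l t - 2 * (t - 1)) (at t)"
      by (rule DERIV_diff[OF divergence_term_deriv[OF t l]]) (auto intro!: derivative_eq_intros)
    moreover have "((\<lambda>x. 2 * box_cox l x - 2 * (x - 1)) has_real_derivative 2 * t powr (l - 1) - 2) (at t)"
      by (rule DERIV_diff[OF DERIV_cmult[OF box_cox_deriv[OF t]]]) (auto intro!: derivative_eq_intros)
    moreover have "((\<lambda>x. 2 * x powr (l - 1) - 2) has_real_derivative 2 * ((l - 1) * t powr (l - 2))) (at t)"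
      by (rule DERIV_cong[OF DERIV_diff[OF DERIV_cmult[OF has_real_derivative_powr[OF t]] DERIV_const]])
         (simp add: algebra_simps)
    moreover have "i = 0 \<or> i = 1 \<or> i = 2" using i by auto
    ultimately show "(diff i has_real_derivative diff (Suc i) t) (at t)"
      by (auto simp: diff_def)
  next
    fix i :: nat assume "i < 3"
    then have "i = 0 \<or> i = 1 \<or> i = 2" by auto
    then show "diff i 1 = 0" by (auto simp: diff_def divergence_term_def)
  qed simp
  moreover have "diff 3 t / fact 3 = (l - 1) / 3 * t powr (l - 2)" for t
    by (simp add: diff_def fact_numeral)
  moreover have "diff 0 x = divergence_term l x - (x - 1)\<^sup>2"
    by (simp add: diff_def)
  ultimately show ?thesis by (simp only:)
qed

lemma box_cox_third_order:
  assumes x: "0 < x"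
  shows "\<exists>c\<ge>0. box_cox l x - (x - 1) - (l - 1) / 2 * (x - 1)\<^sup>2 = c * ((l - 1) * (l - 2) * (x - 1) ^ 3)"
proof -
  define diff where "diff i = (if i = 0 then \<lambda>x. box_cox l x - (x - 1) - (l - 1) / 2 * (x - 1)\<^sup>2
    else if i = 1 then \<lambda>x. x powr (l - 1) - 1 - (l - 1) * (x - 1)
    else if i = 2 then \<lambda>x. (l - 1) * x powr (l - 2) - (l - 1) else (\<lambda>x. (l - 1) * ((l - 2) * x powr (l - 3))))" for i :: nat
  have "\<exists>t>0. diff 0 x = diff 3 t / fact 3 * (x - 1) ^ 3 \<and> (x \<le> t \<and> t \<le> 1 \<or> 1 \<le> t \<and> t \<le> x)"
  proof (rule taylor_about_1[OF x])
    fix i :: nat and t :: real assume i: "i < 3" and t: "0 < t"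
    have "((\<lambda>x. box_cox l x - (x - 1) - (l - 1) / 2 * (x - 1)\<^sup>2) has_real_derivative t powr (l - 1) - 1 - (l - 1) * (t - 1)) (at t)"
      by (rule DERIV_diff[OF DERIV_diff[OF box_cox_deriv[OF t]]]) (auto intro!: derivative_eq_intros)
    moreover have "((\<lambda>x. x powr (l - 1) - 1 - (l - 1) * (x - 1)) has_real_derivative (l - 1) * t powr (l - 2) - (l - 1)) (at t)"
    proof (rule DERIV_diff)
      show "((\<lambda>x. x powr (l - 1) - 1) has_real_derivative (l - 1) * t powr (l - 2)) (at t)"
        by (rule DERIV_cong[OF DERIV_diff[OF has_real_derivative_powr[OF t] DERIV_const]]) (simp add: algebra_simps)
    qed (auto intro!: derivative_eq_intros)
    moreover have "((\<lambda>x. (l - 1) * x powr (l - 2) - (l - 1)) has_real_derivative (l - 1) * ((l - 2) * t powr (l - 3))) (at t)"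
      by (rule DERIV_cong[OF DERIV_diff[OF DERIV_cmult[OF has_real_derivative_powr[OF t]] DERIV_const]])
         (simp add: algebra_simps)
    moreover have "i = 0 \<or> i = 1 \<or> i = 2" using i by auto
    ultimately show "(diff i has_real_derivative diff (Suc i) t) (at t)"
      by (auto simp: diff_def)
  next
    fix i :: nat assume "i < 3"
    then have "i = 0 \<or> i = 1 \<or> i = 2" by auto
    then show "diff i 1 = 0" by (auto simp: diff_def)
  qed simp
  then obtain t where "0 < t" "diff 0 x = diff 3 t / fact 3 * (x - 1) ^ 3" by blast
  then have "diff 0 x = (t powr (l - 3) / 6) * ((l - 1) * (l - 2) * (x - 1) ^ 3)"
    by (simp add: diff_def fact_numeral)
  then show ?thesis
    by (intro exI[of _ "t powr (l - 3) / 6"]) (simp add: diff_def)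
qed

text \<open>The difference is a nonnegative multiple of \<open>(l - 1) (x - 1)\<^sup>3\<close> by third-order Taylor expansion of
  the divergence term. Expanding only the Box-Cox factor, which is multiplied by \<open>x\<close>, shows that the
  multiple is at most \<open>1 / (l + 1)\<close>; this is sharp at \<open>x = 0\<close>, where the former
  expansion blows up.\<close>

lemma divergence_term_minus_square_le_small:
  assumes x: "0 \<le> x" and l: "-1 < l" "l \<le> 2"
  shows "\<bar>divergence_term l x - (x - 1)\<^sup>2\<bar> \<le> \<bar>l - 1\<bar> / (l + 1) * \<bar>x - 1\<bar> ^ 3"
proof (cases "x = 0")
  case True
  have "2 / (l + 1) - 1 = (1 - l) / (l + 1)" using l by (simp add: field_simps)
  then show ?thesis using True l by (simp add: divergence_term_0 abs_minus_commute)
next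
  case False
  then have x: "0 < x" using x by simp
  let ?A = "(l - 1) * (x - 1) ^ 3"
  have lower: "\<exists>c\<ge>0. divergence_term l x - (x - 1)\<^sup>2 = c * ?A"
  proof -
    obtain t where "divergence_term l x - (x - 1)\<^sup>2 = (l - 1) / 3 * t powr (l - 2) * (x - 1) ^ 3"
      using divergence_term_third_order[OF x l(1)] by (elim exE conjE) (rule that)
    then show ?thesis by (intro exI[of _ "t powr (l - 2) / 3"]) simp
  qed
  have upper: "\<exists>c\<ge>0. divergence_term l x - (x - 1)\<^sup>2 = (1 / (l + 1) - c) * ?A"
  proof -
    obtain c where c: "0 \<le> c" "box_cox l x - (x - 1) - (l - 1) / 2 * (x - 1)\<^sup>2 = c * ((l - 1) * (l - 2) * (x - 1) ^ 3)"
      using box_cox_third_order[OF x] by blast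
    have "divergence_term l x - (x - 1)\<^sup>2 - 1 / (l + 1) * ?A
        = 2 * x / (l + 1) * (box_cox l x - (x - 1) - (l - 1) / 2 * (x - 1)\<^sup>2)"
      using l unfolding divergence_term_def
      by (simp add: divide_simps) algebra
    then have "divergence_term l x - (x - 1)\<^sup>2 = (1 / (l + 1) - 2 * x / (l + 1) * c * (2 - l)) * ?A"
    proof -
      have "(i - K * c * (2 - l)) * ((l - 1) * z) = i * ((l - 1) * z) + K * (c * ((l - 1) * (l - 2) * z))" for i K z :: real
        by algebra
      then show ?thesis
        using \<open>divergence_term l x - (x - 1)\<^sup>2 - 1 / (l + 1) * ?A = _\<close> unfolding c(2) by (simp only: diff_eq_eq)
    qed
    moreover have "0 \<le> 2 * x / (l + 1) * c * (2 - l)" using l c(1) x by simp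
    ultimately show ?thesis by (intro exI conjI)
  qed
  obtain c d where c: "0 \<le> c" "divergence_term l x - (x - 1)\<^sup>2 = c * ?A"
    and d: "0 \<le> d" "divergence_term l x - (x - 1)\<^sup>2 = (1 / (l + 1) - d) * ?A"
    using lower upper by blast
  \<comment> \<open>For \<open>?A \<noteq> 0\<close> the two representations have the same
    coefficient, which therefore lies between \<open>0\<close> and
    \<open>1 / (l + 1)\<close>.\<close>
  have "\<bar>divergence_term l x - (x - 1)\<^sup>2\<bar> \<le> 1 / (l + 1) * \<bar>?A\<bar>"
  proof (cases "?A = 0")
    case False
    then have "c = 1 / (l + 1) - d" using c(2) d(2) by simp
    then have "c \<le> 1 / (l + 1)" using d(1) by simp
    then show ?thesis unfolding c(2) abs_mult using c(1) by (intro mult_right_mono) auto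
  next
    case True
    then have "divergence_term l x - (x - 1)\<^sup>2 = 0" using c(2) by (simp only: mult_zero_right)
    then show ?thesis using l by simp
  qed
  then show ?thesis by (simp add: abs_mult power_abs)
qed

text \<open>In the third-order remainder \<open>t\<close> lies between \<open>x\<close> and
  \<open>1\<close>, so \<open>t powr (l - 2)\<close> is at most the larger of \<open>1\<close> and
  \<open>x powr (l - 2)\<close>, hence at most their sum.\<close>

lemma divergence_term_minus_square_le_large:
  assumes x: "0 \<le> x" and l: "2 \<le> l"
  shows "\<bar>divergence_term l x - (x - 1)\<^sup>2\<bar> \<le> (l - 1) / 3 * ((1 + x powr (l - 2)) * \<bar>x - 1\<bar> ^ 3)"
proof (cases "x = 0")
  case True
  have "\<bar>2 / (l + 1) - 1\<bar> = (l - 1) / (l + 1)" using l by (simp add: field_simps)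
  also have "\<dots> \<le> (l - 1) / 3" using l by (intro divide_left_mono) auto
  finally show ?thesis using True l by (simp add: divergence_term_0)
next
  case False
  then have x: "0 < x" using x by simp
  obtain t where t: "0 < t" "divergence_term l x - (x - 1)\<^sup>2 = (l - 1) / 3 * t powr (l - 2) * (x - 1) ^ 3"
    "x \<le> t \<and> t \<le> 1 \<or> 1 \<le> t \<and> t \<le> x"
    using divergence_term_third_order[OF x, of l] l by (auto simp del: times_divide_eq_left)
  have "t powr (l - 2) \<le> 1 + x powr (l - 2)"
  proof (cases "t \<le> 1")
    case True
    then have "t powr (l - 2) \<le> 1 powr (l - 2)" using t(1) l by (intro powr_mono2) auto
    then show ?thesis by (simp add: add_increasing2)
  next
    case False
    then have "t powr (l - 2) \<le> x powr (l - 2)" using t(1,3) l by (intro powr_mono2) auto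
    then show ?thesis by simp
  qed
  then have "(l - 1) / 3 * (t powr (l - 2) * \<bar>x - 1\<bar> ^ 3) \<le> (l - 1) / 3 * ((1 + x powr (l - 2)) * \<bar>x - 1\<bar> ^ 3)"
    using l by (intro mult_left_mono mult_right_mono) auto
  moreover have "\<bar>(l - 1) / 3 * t powr (l - 2) * (x - 1) ^ 3\<bar> = (l - 1) / 3 * (t powr (l - 2) * \<bar>x - 1\<bar> ^ 3)"
    using l by (simp add: abs_mult power_abs)
  ultimately show ?thesis
    unfolding t(2) by (simp only:)
qed

section \<open>Moment bounds for the comparison\<close>

lemma exp_le_cubic:
  fixes y :: real
  assumes y: "0 \<le> y" "y \<le> 1"
  shows "exp y \<le> 1 + y + y\<^sup>2 / 2 + y ^ 3 / 4"
proof -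
  obtain t where t: "\<bar>t\<bar> \<le> \<bar>y\<bar>" "exp y = (\<Sum>i<5. y ^ i / fact i) + exp t / fact 5 * y ^ 5"
    using Maclaurin_exp_le[of y 5] by blast
  have "exp t \<le> exp 1" using t(1) y by simp
  then have "exp t \<le> 3" using exp_le by linarith
  then have "exp t / fact 5 * y ^ 5 \<le> 3 / fact 5 * y ^ 3"
    using y by (intro mult_mono divide_right_mono power_decreasing) auto
  moreover have "y ^ 4 \<le> y ^ 3" using y by (intro power_decreasing) auto
  moreover have "0 \<le> y ^ 3" using y by simp
  \<comment> \<open>The cubic coefficient is enough because \<open>1/6 + 1/24 + 3/120\<close> is
    below \<open>1/4\<close>.\<close>
  ultimately show ?thesis
    using t(2) by (simp add: fact_numeral eval_nat_numeral)
qed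

context class_probabilities
begin

text \<open>Chernoff-type bound: \<open>ln x \<le> x / c - 1 + ln c\<close> turns the power into an exponential;
  \<open>c = 1 + \<kappa> / (2 n p\<^sub>j)\<close> is optimal to first order.\<close>

lemma E_powr_le:
  assumes j: "j \<in> {1..r}" and k: "0 \<le> \<kappa>" "\<kappa> \<le> 2 * (real n * p j)" and N: "0 < real n * p j"
  shows "E n (\<lambda>u. (real (u j) / (real n * p j)) powr \<kappa>) \<le> exp (\<kappa>\<^sup>2 / (2 * (real n * p j)))"
proof -
  define N where "N = real n * p j"
  define \<theta> where "\<theta> = \<kappa> / N"
  define c where "c = 1 + \<theta> / 2"
  have N: "0 < N" using N by (simp add: N_def)
  have \<theta>: "0 \<le> \<theta>" "\<theta> \<le> 2" "\<kappa> = N * \<theta>"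
    using k N by (auto simp: \<theta>_def N_def[symmetric] field_simps)
  have c: "0 < c" using \<theta> by (simp add: c_def)
  define y where "y = \<theta> / c"
  \<comment> \<open>\<open>y \<le> 1\<close> amounts to \<open>\<theta> \<le> 2\<close>, that is to
    the hypothesis \<open>\<kappa> \<le> 2 * (real n * p j)\<close>.\<close>
  have y: "0 \<le> y" "y \<le> 1" using \<theta> c by (auto simp: y_def c_def field_simps)
  have pw: "(real (u j) / N) powr \<kappa> \<le> exp (\<kappa> * (ln c - 1)) * exp (y * real (u j))" for u :: "nat \<Rightarrow> nat"
  proof (cases "u j = 0")
    case False
    let ?x = "real (u j) / N"
    have x: "0 < ?x" using False N by simp
    have "ln z - ln c \<le> z / c - 1" if "0 < z" for z
      using ln_le_minus_one[of "z / c"] that c by (simp add: ln_div)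
    from this[OF x] have "ln ?x - ln c \<le> ?x / c - 1" .
    then have "\<kappa> * ln ?x \<le> \<kappa> * (ln c - 1 + ?x / c)"
      using k by (intro mult_left_mono) auto
    also have "\<dots> = \<kappa> * (ln c - 1) + y * real (u j)"
      using N by (simp add: y_def \<theta>_def distrib_left)
    finally show ?thesis
      using x by (simp add: powr_def flip: exp_add)
  qed simp
  have "E n (\<lambda>u. (real (u j) / N) powr \<kappa>) \<le> E n (\<lambda>u. exp (\<kappa> * (ln c - 1)) * exp (y * real (u j)))"
    by (intro E_mono pw)
  also have "\<dots> \<le> exp (\<kappa> * (ln c - 1)) * exp (N * (exp y - 1))"
    unfolding E_cmult N_def by (intro mult_left_mono E_exp_le j) simp
  also have "\<dots> = exp (N * (\<theta> * (ln c - 1) + (exp y - 1)))"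
    unfolding \<theta>(3) by (simp add: algebra_simps flip: exp_add)
  also have "\<dots> \<le> exp (N * (\<theta>\<^sup>2 / 2))"
  proof -
    have "\<theta> * (ln c - 1) \<le> \<theta> * (\<theta> / 2 - 1)"
      using ln_le_minus_one[OF c] \<theta> by (intro mult_left_mono) (auto simp: c_def)
    moreover have "\<theta> * (\<theta> / 2 - 1) + (y + y\<^sup>2 / 2 + y ^ 3 / 4) \<le> \<theta>\<^sup>2 / 2"
    proof -
      \<comment> \<open>\<open>z\<close> is \<open>y / 2\<close>; applying
        \<open>\<theta> - 2 * z = \<theta> * z\<close> three times collapses the difference of the
        two sides to \<open>\<theta> * z ^ 3\<close>.\<close>
      define z where "z = \<theta> / (2 + \<theta>)"
      have z: "\<theta> - 2 * z = \<theta> * z" "y = 2 * z"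
        using \<theta> by (simp_all add: z_def y_def c_def field_simps)
      have "\<theta>\<^sup>2 / 2 - (\<theta> * (\<theta> / 2 - 1) + (y + y\<^sup>2 / 2 + y ^ 3 / 4)) = \<theta> - 2 * z - 2 * z\<^sup>2 - 2 * z ^ 3"
        unfolding z(2) by (simp add: field_simps power2_eq_square power3_eq_cube)
      also have "\<dots> = \<theta> * z ^ 3"
        using z(1) by algebra
      finally have "\<theta>\<^sup>2 / 2 - (\<theta> * (\<theta> / 2 - 1) + (y + y\<^sup>2 / 2 + y ^ 3 / 4)) = \<theta> * z ^ 3" .
      moreover have "0 \<le> \<theta> * z ^ 3" using \<theta> by (simp add: z_def)
      ultimately show ?thesis by linarith
    qed
    ultimately have "\<theta> * (ln c - 1) + (exp y - 1) \<le> \<theta>\<^sup>2 / 2"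
      using exp_le_cubic[OF y] by linarith
    then show ?thesis using N by (simp add: mult_left_mono)
  qed
  also have "N * (\<theta>\<^sup>2 / 2) = \<kappa>\<^sup>2 / (2 * N)"
    using N by (simp add: \<theta>_def power2_eq_square)
  finally show ?thesis by (simp add: N_def)
qed

lemma power_divergence_eq_sum:
  assumes u: "(\<Sum>j=1..r. u j) = n" and n: "0 < n" and l: "-1 < l"
  shows "power_divergence l n r p u = (\<Sum>j=1..r. real n * p j * divergence_term l (real (u j) / (real n * p j)))"
proof -
  have "real n * p j * divergence_term l (real (u j) / (real n * p j))
      = 2 / (l + 1) * (real (u j) * box_cox l (real (u j) / (real n * p j))) - 2 / (l + 1) * (real (u j) - real n * p j)"
    if "j \<in> {1..r}" for j
  proof -
    have "N * (a * (x / N * b - (x / N - 1))) = a * (x * b) - a * (x - N)" if "0 < N" for N a x b :: real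
      using that by (simp add: field_simps)
    from this[of "real n * p j" "2 / (l + 1)"] show ?thesis
      using p_pos[OF that] n by (simp add: divergence_term_def)
  qed
  then have "(\<Sum>j=1..r. real n * p j * divergence_term l (real (u j) / (real n * p j)))
      = 2 / (l + 1) * (\<Sum>j=1..r. real (u j) * box_cox l (real (u j) / (real n * p j)))
        - 2 / (l + 1) * (\<Sum>j=1..r. real (u j) - real n * p j)"
    unfolding sum_distrib_left sum_subtractf[symmetric] by (rule sum.cong[OF refl])
  also have "(\<Sum>j=1..r. real (u j) - real n * p j) = 0" by (rule sum_centered[OF u])
  also have "2 / (l + 1) * (\<Sum>j=1..r. real (u j) * box_cox l (real (u j) / (real n * p j))) - 2 / (l + 1) * 0
      = power_divergence l n r p u"
  proof (cases "l = 0")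
    case True
    then show ?thesis by (simp add: power_divergence_def box_cox_def)
  next
    case False
    have "2 / (l + 1) * (\<Sum>j=1..r. real (u j) * ((X j - 1) / l)) = 2 / (l * (l + 1)) * (\<Sum>j=1..r. real (u j) * (X j - 1))" for X :: "nat \<Rightarrow> real"
      by (simp flip: sum_divide_distrib)
    then show ?thesis using False by (simp add: power_divergence_def box_cox_def)
  qed
  finally show ?thesis ..
qed

lemma power_divergence_nonneg:
  assumes "(\<Sum>j=1..r. u j) = n" "0 < n" "-1 < l"
  shows "0 \<le> power_divergence l n r p u"
  unfolding power_divergence_eq_sum[OF assms]
proof (rule sum_nonneg)
  fix j assume "j \<in> {1..r}"
  then show "0 \<le> real n * p j * divergence_term l (real (u j) / (real n * p j))"
    using divergence_term_nonneg[of "real (u j) / (real n * p j)" l] assms(3) p_pos[of j] by simp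
qed

lemma E_divergence_term_minus_square_le:
  assumes j: "j \<in> {1..r}" and l: "-1 < l" and np: "2 \<le> real n * p j"
    and np_l: "2 \<le> l \<Longrightarrow> 2 * (l - 2)\<^sup>2 \<le> real n * p j"
  defines "x \<equiv> \<lambda>u :: nat \<Rightarrow> nat. real (u j) / (real n * p j)"
  shows "E n (\<lambda>u. real n * p j * \<bar>divergence_term l (x u) - (x u - 1)\<^sup>2\<bar>)
    \<le> \<bar>l - 1\<bar> * (4 * l + 7) / (l + 1) * (1 / sqrt (real n * p j))"
proof -
  define N where "N = real n * p j"
  define q where "q = 1 / sqrt N"
  define s where "s u = (real (u j) - N) / sqrt N" for u :: "nat \<Rightarrow> nat"
  note mom = E_standardized_moments[OF j order_refl np, folded N_def, folded s_def]
  have N: "2 \<le> N" using np by (simp add: N_def)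
  have q: "0 < q" using N by (simp add: q_def)
  have x0: "0 \<le> x u" for u using N by (simp add: x_def flip: N_def)
  \<comment> \<open>Since \<open>x u - 1 = q * s u\<close> and \<open>N * q\<^sup>2 = 1\<close>,
    exactly one factor \<open>q\<close> survives; it is the rate in the bound.\<close>
  have cube: "N * \<bar>x u - 1\<bar> ^ 3 = q * \<bar>s u\<bar> ^ 3" for u
  proof -
    have "x u - 1 = q * s u"
      using N by (simp add: x_def s_def q_def field_simps flip: N_def)
    moreover have "N * q\<^sup>2 = 1" using N by (simp add: q_def power_divide)
    moreover have "N * \<bar>q * s u\<bar> ^ 3 = (N * q\<^sup>2) * (q * \<bar>s u\<bar> ^ 3)"
      using q by (simp add: abs_mult power2_eq_square power3_eq_cube mult_ac)
    ultimately show ?thesis by simp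
  qed
  show ?thesis
  proof (cases "l \<le> 2")
    case True
    have "N * \<bar>divergence_term l (x u) - (x u - 1)\<^sup>2\<bar> \<le> (\<bar>l - 1\<bar> / (l + 1) * q) * \<bar>s u\<bar> ^ 3" for u
    proof -
      have "N * \<bar>divergence_term l (x u) - (x u - 1)\<^sup>2\<bar> \<le> N * (\<bar>l - 1\<bar> / (l + 1) * \<bar>x u - 1\<bar> ^ 3)"
        using N by (intro mult_left_mono divergence_term_minus_square_le_small x0 l True) auto
      also have "\<dots> = \<bar>l - 1\<bar> / (l + 1) * (N * \<bar>x u - 1\<bar> ^ 3)" by simp
      finally show ?thesis unfolding cube by (simp add: mult_ac)
    qed
    then have "E n (\<lambda>u. N * \<bar>divergence_term l (x u) - (x u - 1)\<^sup>2\<bar>) \<le> (\<bar>l - 1\<bar> / (l + 1) * q) * E n (\<lambda>u. \<bar>s u\<bar> ^ 3)"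
      unfolding E_cmult[symmetric] by (intro E_mono)
    also have "\<dots> \<le> (\<bar>l - 1\<bar> / (l + 1) * q) * (4 * l + 7)"
      \<comment> \<open>\<open>15 / 8 \<le> 4 * l + 7\<close> because \<open>-1 < l\<close>.\<close>
      using mom(3) l q by (intro mult_left_mono) auto
    finally show ?thesis by (simp add: N_def q_def mult_ac)
  next
    case False
    then have l2: "2 \<le> l" by simp
    define \<mu> where "\<mu> = l - 2"
    have \<mu>: "0 \<le> \<mu>" "2 * \<mu>\<^sup>2 \<le> N" using l2 np_l by (auto simp: \<mu>_def N_def)
    \<comment> \<open>Young's inequality with equality at \<open>a = b / 2\<close>; the small weight
      \<open>1 / 32\<close> offsets the large bound on the moment of
      \<open>x u powr (4 * \<mu>)\<close>.\<close>
    have young: "\<bar>s u\<bar> ^ 3 * x u powr \<mu> \<le> 3 / 2 * s u ^ 4 + 1 / 32 * x u powr (4 * \<mu>)" for u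
    proof -
      have "a ^ 3 * b \<le> 3 / 2 * a ^ 4 + 1 / 32 * b ^ 4" for a b :: real
      proof -
        have "3 / 2 * a ^ 4 + 1 / 32 * b ^ 4 - a ^ 3 * b = 1 / 2 * (a - b / 2)\<^sup>2 * (2 * a\<^sup>2 + (a + b / 2)\<^sup>2)"
          by (simp add: field_simps) algebra
        moreover have "0 \<le> 1 / 2 * (a - b / 2)\<^sup>2 * (2 * a\<^sup>2 + (a + b / 2)\<^sup>2)" by simp
        ultimately show ?thesis by linarith
      qed
      from this[of "\<bar>s u\<bar>" "x u powr \<mu>"] show ?thesis
        using powr_power[of "x u" \<mu> 4] by (cases "x u = 0") simp_all
    qed
    \<comment> \<open>The Chernoff exponent \<open>(4 * \<mu>)\<^sup>2 / (2 * N)\<close> is at most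
      \<open>4\<close> exactly when \<open>2 * \<mu>\<^sup>2 \<le> N\<close>, the hypothesis made
      for \<open>2 \<le> l\<close>; and \<open>exp 4\<close> is below \<open>56\<close>.\<close>
    have raw: "E n (\<lambda>u. x u powr (4 * \<mu>)) \<le> 56"
    proof -
      have "(4 * \<mu>)\<^sup>2 \<le> (2 * N)\<^sup>2"
      proof -
        have "8 * (2 * \<mu>\<^sup>2) \<le> 4 * (2 * N)" using \<mu> by simp
        also have "\<dots> \<le> 4 * (N * N)" using N by (intro mult_left_mono mult_right_mono) auto
        finally show ?thesis by (simp add: power2_eq_square)
      qed
      then have "4 * \<mu> \<le> 2 * N" by (rule power2_le_imp_le) (use N in simp)
      then have "E n (\<lambda>u. x u powr (4 * \<mu>)) \<le> exp ((4 * \<mu>)\<^sup>2 / (2 * N))"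
        unfolding x_def using E_powr_le[OF j, of "4 * \<mu>" n] \<mu> N by (simp add: N_def)
      also have "\<dots> \<le> exp 4" using \<mu> N by (simp add: divide_le_eq power_mult_distrib)
      also have "exp 4 = exp (1::real) ^ 4" by (simp flip: exp_of_nat_mult)
      also have "\<dots> \<le> (272 / 100) ^ 4" using e_less_272 by (intro power_mono) auto
      also have "\<dots> \<le> (56 :: real)" by (simp add: power_divide)
      finally show ?thesis .
    qed
    have "N * \<bar>divergence_term l (x u) - (x u - 1)\<^sup>2\<bar>
        \<le> ((l - 1) / 3 * q) * (\<bar>s u\<bar> ^ 3 + (3 / 2 * s u ^ 4 + 1 / 32 * x u powr (4 * \<mu>)))" for u
    proof -
      have regroup: "a * (1 + b) * (q * c) = (a * q) * (c + c * b)" for a b c :: real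
        by (simp add: algebra_simps)
      have "N * \<bar>divergence_term l (x u) - (x u - 1)\<^sup>2\<bar> \<le> N * ((l - 1) / 3 * ((1 + x u powr (l - 2)) * \<bar>x u - 1\<bar> ^ 3))"
        using N by (intro mult_left_mono divergence_term_minus_square_le_large x0 l2) auto
      also have "\<dots> = (l - 1) / 3 * (1 + x u powr \<mu>) * (N * \<bar>x u - 1\<bar> ^ 3)" by (simp add: \<mu>_def)
      also have "\<dots> = ((l - 1) / 3 * q) * (\<bar>s u\<bar> ^ 3 + \<bar>s u\<bar> ^ 3 * x u powr \<mu>)"
        unfolding cube by (rule regroup)
      also have "\<dots> \<le> ((l - 1) / 3 * q) * (\<bar>s u\<bar> ^ 3 + (3 / 2 * s u ^ 4 + 1 / 32 * x u powr (4 * \<mu>)))"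
        using l2 q by (intro mult_left_mono add_left_mono young) auto
      finally show ?thesis .
    qed
    then have "E n (\<lambda>u. N * \<bar>divergence_term l (x u) - (x u - 1)\<^sup>2\<bar>)
        \<le> ((l - 1) / 3 * q) * (E n (\<lambda>u. \<bar>s u\<bar> ^ 3) + (3 / 2 * E n (\<lambda>u. s u ^ 4) + 1 / 32 * E n (\<lambda>u. x u powr (4 * \<mu>))))"
      unfolding E_cmult[symmetric] E_add[symmetric] by (intro E_mono)
    \<comment> \<open>\<open>15/8 + 3/2 * 7/2 + 56/32 = 71/8\<close>, which is below
      \<open>12\<close>.\<close>
    also have "\<dots> \<le> ((l - 1) / 3 * q) * 12"
      using mom(2,3) raw l2 q by (intro mult_left_mono) auto
    also have "\<dots> \<le> ((l - 1) * (4 * l + 7) / (l + 1)) * q"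
    proof -
      have "4 \<le> (4 * l + 7) / (l + 1)" using l2 by (simp add: le_divide_eq)
      then have "(l - 1) * 4 * q \<le> (l - 1) * ((4 * l + 7) / (l + 1)) * q"
        using l2 q by (intro mult_left_mono mult_right_mono) auto
      moreover have "(l - 1) / 3 * q * 12 = (l - 1) * 4 * q"
        by (simp add: field_simps)
      ultimately show ?thesis by (simp only: times_divide_eq_right)
    qed
    finally show ?thesis using l2 by (simp add: N_def q_def)
  qed
qed

lemma E_power_divergence_minus_pearson_le:
  assumes l: "-1 < l" and np: "\<And>j. j \<in> {1..r} \<Longrightarrow> 2 \<le> real n * p j"
    and np_l: "\<And>j. j \<in> {1..r} \<Longrightarrow> 2 \<le> l \<Longrightarrow> 2 * (l - 2)\<^sup>2 \<le> real n * p j"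
  shows "E n (\<lambda>u. \<bar>power_divergence l n r p u - pearson n n u\<bar>)
    \<le> \<bar>l - 1\<bar> * (4 * l + 7) / (l + 1) * (\<Sum>j=1..r. 1 / sqrt (real n * p j))"
proof -
  have n: "0 < n" using np[of 1] r_pos by (cases n) auto
  let ?x = "\<lambda>j u. real (u j) / (real n * p j)"
  have "E n (\<lambda>u. \<bar>power_divergence l n r p u - pearson n n u\<bar>)
      \<le> E n (\<lambda>u. \<Sum>j=1..r. real n * p j * \<bar>divergence_term l (?x j u) - (?x j u - 1)\<^sup>2\<bar>)"
  proof (rule E_mono)
    fix u :: "nat \<Rightarrow> nat" assume u: "(\<Sum>j=1..r. u j) = n"
    have "pearson n n u = (\<Sum>j=1..r. real n * p j * (?x j u - 1)\<^sup>2)"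
      unfolding pearson_def
    proof (rule sum.cong[OF refl])
      fix j assume "j \<in> {1..r}"
      have "(a - N)\<^sup>2 / N = N * (a / N - 1)\<^sup>2" if "0 < N" for a N :: real
        using that by (simp add: field_simps power2_eq_square)
      from this[of "real n * p j"] show "(real (u j) - real n * p j)\<^sup>2 / (real n * p j) = real n * p j * (?x j u - 1)\<^sup>2"
        using p_pos[OF \<open>j \<in> {1..r}\<close>] n by simp
    qed
    then have diff: "power_divergence l n r p u - pearson n n u
        = (\<Sum>j=1..r. real n * p j * (divergence_term l (?x j u) - (?x j u - 1)\<^sup>2))"
      unfolding power_divergence_eq_sum[OF u n l] by (simp add: sum_subtractf right_diff_distrib)
    show "\<bar>power_divergence l n r p u - pearson n n u\<bar>
        \<le> (\<Sum>j=1..r. real n * p j * \<bar>divergence_term l (?x j u) - (?x j u - 1)\<^sup>2\<bar>)"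
      unfolding diff
    proof (rule order_trans[OF sum_abs sum_mono])
      fix j assume "j \<in> {1..r}"
      then have nonneg: "0 \<le> real n * p j" using np by force
      have "\<bar>N * a\<bar> \<le> N * \<bar>a\<bar>" if "0 \<le> N" for N a :: real
        using that by (simp add: abs_mult)
      from this[OF nonneg] show "\<bar>real n * p j * (divergence_term l (?x j u) - (?x j u - 1)\<^sup>2)\<bar>
          \<le> real n * p j * \<bar>divergence_term l (?x j u) - (?x j u - 1)\<^sup>2\<bar>"
        .
    qed
  qed
  also have "\<dots> \<le> (\<Sum>j=1..r. \<bar>l - 1\<bar> * (4 * l + 7) / (l + 1) * (1 / sqrt (real n * p j)))"
    unfolding E_sum[OF finite_atLeastAtMost] by (intro sum_mono E_divergence_term_minus_square_le l np np_l)
  finally show ?thesis by (simp only: sum_distrib_left)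
qed

end

section \<open>Combination of the estimates\<close>

context class_probabilities
begin

lemma pearson_chi_square_bounds:
  fixes h :: "real \<Rightarrow> real" and n :: nat
  assumes r: "2 \<le> r" and np: "\<And>j. j \<in> {1..r} \<Longrightarrow> 2 \<le> real n * p j"
    and h_deriv: "\<And>x. 0 \<le> x \<Longrightarrow> (h has_real_derivative h1 x) (at x within {0..})"
    and h1_deriv: "\<And>x. 0 \<le> x \<Longrightarrow> (h1 has_real_derivative h2 x) (at x within {0..})"
    and h1_bound: "\<And>x. 0 \<le> x \<Longrightarrow> \<bar>h1 x\<bar> \<le> H1"
    and h2_bound: "\<And>x. 0 \<le> x \<Longrightarrow> \<bar>h2 x\<bar> \<le> H2"
  defines "\<Delta> \<equiv> \<bar>E n (\<lambda>u. h (pearson n n u)) - chi_square_expectation (r - 1) h\<bar>"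
    and "S \<equiv> \<Sum>j=1..r. 1 / sqrt (real n * p j)"
  shows "\<Delta> \<le> 1 / sqrt (real r + 1) * (115 * H1 + 536 * H2) * S"
    and "(\<And>x. 0 \<le> x \<Longrightarrow> \<bar>h x\<bar> \<le> H0) \<Longrightarrow> \<Delta> \<le> 24 / (real r + 1) * (3 * H0 + 23 * H1 + 42 * H2) * S"
proof -
  \<comment> \<open>\<open>m\<close> is \<open>k + 2\<close> for \<open>k = r - 1\<close> degrees of
    freedom.\<close>
  define m where "m = real r + 1"
  have m: "3 \<le> m" "real (r - 1) = m - 2" "real (r - 1) + 2 = m" "real (r - 1) + 4 = m + 2"
    using r by (auto simp: m_def of_nat_diff)
  have H: "0 \<le> H1" "0 \<le> H2" using h1_bound[of 0] h2_bound[of 0] by auto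
  have S: "0 \<le> S" unfolding S_def
  proof (rule sum_nonneg)
    fix j assume "j \<in> {1..r}"
    from np[OF this] show "0 \<le> 1 / sqrt (real n * p j)" by simp
  qed
  have "1 \<le> r - 1" using r by simp
  from stein_factors[OF this h_deriv h1_deriv h1_bound h2_bound, unfolded m(3,4)]
  obtain g g1 where
    eq: "\<And>x. 0 \<le> x \<Longrightarrow> real (r - 1) / 2 * g x + x * g1 x - x / 2 * g x = h x - chi_square_expectation (r - 1) h"
    and smooth: "\<And>x. 0 \<le> x \<Longrightarrow> \<bar>g1 x\<bar> \<le> 16 * H1 / sqrt m"
    and bounded: "\<And>H0 x. (\<And>x. 0 \<le> x \<Longrightarrow> \<bar>h x\<bar> \<le> H0) \<Longrightarrow> 0 \<le> x \<Longrightarrow> \<bar>g1 x\<bar> \<le> 4 * (H0 + H1) / m"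
    and expand: "\<And>B x y. (\<And>x. 0 \<le> x \<Longrightarrow> \<bar>g1 x\<bar> \<le> B) \<Longrightarrow> 0 \<le> x \<Longrightarrow> 0 \<le> y \<Longrightarrow>
       \<bar>g y - g x - g1 x * (y - x)\<bar> \<le> (2 * H1 + H2 + B) / (m + 2) * (y - x)\<^sup>2"
    and lip: "\<And>B x y. (\<And>x. 0 \<le> x \<Longrightarrow> \<bar>g1 x\<bar> \<le> B) \<Longrightarrow> 0 \<le> x \<Longrightarrow> 0 \<le> y \<Longrightarrow>
       \<bar>(real (r - 1) / 2 * g y + y * g1 y) - (real (r - 1) / 2 * g x + x * g1 x)\<bar>
         \<le> (m / 2 * B + 4 * H1) * \<bar>y - x\<bar>"
    by blast
  have main: "\<Delta> \<le> (1.86 * B + 8.1 * ((2 * H1 + H2 + B) / (m + 2)) + 2.72 / real r * (m / 2 * B + 4 * H1)) * S"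
    if B: "\<And>x. 0 \<le> x \<Longrightarrow> \<bar>g1 x\<bar> \<le> B" for B
  proof -
    let ?G = "\<lambda>x. real (r - 1) / 2 * g x + x * g1 x"
    have B0: "0 \<le> B" using B[of 0] by simp
    have "E n (\<lambda>u. h (pearson n n u)) - chi_square_expectation (r - 1) h
        = E n (\<lambda>u. h (pearson n n u) - chi_square_expectation (r - 1) h)"
      by (simp add: E_diff E_const)
    also have "\<dots> = E n (\<lambda>u. ?G (pearson n n u) - pearson n n u / 2 * g (pearson n n u))"
      by (rule E_cong) (simp only: eq[OF pearson_nonneg])
    finally have "\<Delta> = \<bar>E n (\<lambda>u. ?G (pearson n n u) - pearson n n u / 2 * g (pearson n n u))\<bar>"
      by (simp add: \<Delta>_def)
    moreover have "\<bar>E n (\<lambda>u. ?G (pearson n n u) - pearson n n u / 2 * g (pearson n n u))\<bar>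
        \<le> (1.86 * B + 8.1 * ((2 * H1 + H2 + B) / (m + 2)) + 2.72 / real r * (m / 2 * B + 4 * H1)) * S"
      unfolding S_def
      by (rule pearson_stein_bound[OF np B expand[OF B] _ lip[OF B]])
         (use B0 H m r in \<open>auto simp: of_nat_diff\<close>)
    ultimately show ?thesis by simp
  qed
  \<comment> \<open>\<open>m / r \<le> 3/2\<close> because \<open>2 \<le> r\<close>, and
    \<open>2.72 * 3/2 = 4.08\<close>.\<close>
  have inv_r: "2.72 / real r \<le> 4.08 / m"
    using r by (simp add: m_def field_simps)
  have coarse: "2.72 / real r * (m / 2 * B + 4 * H1) \<le> 2.04 * B + 16.32 * (H1 / m)" if "0 \<le> B" for B
  proof -
    have "2.72 / real r * (m / 2 * B + 4 * H1) \<le> 4.08 / m * (m / 2 * B + 4 * H1)"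
      using inv_r that m(1) H by (intro mult_right_mono) auto
    also have "\<dots> = 2.04 * B + 16.32 * (H1 / m)"
      using m(1) by (simp add: field_simps)
    finally show ?thesis .
  qed
  show "\<Delta> \<le> 1 / sqrt (real r + 1) * (115 * H1 + 536 * H2) * S"
  proof -
    define t where "t = sqrt m"
    have t: "0 < t" "t\<^sup>2 = m" "1 \<le> t" using m(1) by (auto simp: t_def)
    let ?B = "16 * (H1 / t)"
    have B0: "0 \<le> ?B" using H t by simp
    \<comment> \<open>Expanding gives \<open>2.8 * t \<le> m + 1.96\<close>, a linear bound on
      \<open>t = sqrt m\<close> that converts \<open>1 / (m + 2)\<close> into order
      \<open>1 / t\<close>.\<close>
    have "0 \<le> (t - 1.4)\<^sup>2" by simp
    then have "t \<le> 0.36 * (m + 2)"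
      using t(2) m(1) by (simp add: power2_eq_square algebra_simps)
    then have inv1: "1 / (m + 2) \<le> 0.36 / t" using t m(1) by (simp add: field_simps)
    \<comment> \<open>\<open>?B\<close> already carries a factor \<open>1 / t\<close>, so a constant
      bound is enough for its quotient.\<close>
    have inv2: "1 / (m + 2) \<le> 1 / 5" using m(1) by simp
    have "t \<le> m" using t by (metis less_imp_le mult.right_neutral mult_left_mono power2_eq_square)
    then have inv3: "H1 / m \<le> H1 / t" using t m(1) H by (intro divide_left_mono) auto
    have "(2 * H1 + H2 + ?B) / (m + 2) = (2 * H1 + H2) * (1 / (m + 2)) + ?B * (1 / (m + 2))"
      by (simp add: add_divide_distrib)
    also have "\<dots> \<le> (2 * H1 + H2) * (0.36 / t) + ?B * (1 / 5)"
      using H B0 by (intro add_mono mult_left_mono inv1 inv2) auto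
    also have "\<dots> = (0.72 + 3.2) * (H1 / t) + 0.36 * (H2 / t)"
      using t(1) by (simp add: field_simps)
    finally have D: "(2 * H1 + H2 + ?B) / (m + 2) \<le> (0.72 + 3.2) * (H1 / t) + 0.36 * (H2 / t)" .
    have "2.72 / real r * (m / 2 * ?B + 4 * H1) \<le> 2.04 * ?B + 16.32 * (H1 / t)"
      by (rule order_trans[OF coarse[OF B0] add_left_mono[OF mult_left_mono[OF inv3]]]) simp
    then have "1.86 * ?B + 8.1 * ((2 * H1 + H2 + ?B) / (m + 2)) + 2.72 / real r * (m / 2 * ?B + 4 * H1)
        \<le> 1.86 * ?B + 8.1 * ((0.72 + 3.2) * (H1 / t) + 0.36 * (H2 / t)) + (2.04 * ?B + 16.32 * (H1 / t))"
      by (rule add_mono[OF add_mono[OF order_refl mult_left_mono[OF D]], rotated]) simp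
    also have "\<dots> \<le> 115 * (H1 / t) + 536 * (H2 / t)"
    proof -
      have "1.86 * (16 * a) + 8.1 * ((0.72 + 3.2) * a + 0.36 * b) + (2.04 * (16 * a) + 16.32 * a)
          \<le> 115 * a + 536 * b" if "0 \<le> a" "0 \<le> b" for a b :: real
        using that by (simp add: field_simps)
      from this[OF divide_nonneg_pos[OF H(1) t(1)] divide_nonneg_pos[OF H(2) t(1)]] show ?thesis .
    qed
    also have "\<dots> = 1 / t * (115 * H1 + 536 * H2)"
      by (simp add: algebra_simps)
    finally have "(1.86 * ?B + 8.1 * ((2 * H1 + H2 + ?B) / (m + 2)) + 2.72 / real r * (m / 2 * ?B + 4 * H1)) * S
        \<le> 1 / t * (115 * H1 + 536 * H2) * S"
      using S by (rule mult_right_mono)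
    moreover have "\<bar>g1 x\<bar> \<le> ?B" if "0 \<le> x" for x
      using smooth[OF that] by (simp add: t_def)
    ultimately show ?thesis
      using main[of ?B] by (simp add: t_def m_def)
  qed
  show "\<Delta> \<le> 24 / (real r + 1) * (3 * H0 + 23 * H1 + 42 * H2) * S"
    if H0: "\<And>x. 0 \<le> x \<Longrightarrow> \<bar>h x\<bar> \<le> H0"
  proof -
    have H0': "0 \<le> H0" using H0[of 0] by simp
    let ?B = "4 * ((H0 + H1) / m)"
    have B0: "0 \<le> ?B" using H H0' m(1) by simp
    have B: "?B \<le> 4 / 3 * (H0 + H1)"
    proof -
      have "(H0 + H1) / m \<le> (H0 + H1) / 3"
        using H H0' m(1) by (intro divide_left_mono) auto
      from mult_left_mono[OF this, of 4] show ?thesis by simp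
    qed
    have "(2 * H1 + H2 + ?B) / (m + 2) \<le> (2 * H1 + H2 + 4 / 3 * (H0 + H1)) / m"
      using H H0' B0 B m(1) by (intro frac_le add_nonneg_nonneg mult_nonneg_nonneg) auto
    also have "\<dots> = 10 / 3 * (H1 / m) + H2 / m + 4 / 3 * (H0 / m)"
      by (simp add: add_divide_distrib algebra_simps)
    finally have D: "(2 * H1 + H2 + ?B) / (m + 2) \<le> 10 / 3 * (H1 / m) + H2 / m + 4 / 3 * (H0 / m)" .
    have "1.86 * ?B + 8.1 * ((2 * H1 + H2 + ?B) / (m + 2)) + 2.72 / real r * (m / 2 * ?B + 4 * H1)
        \<le> 1.86 * ?B + 8.1 * (10 / 3 * (H1 / m) + H2 / m + 4 / 3 * (H0 / m)) + (2.04 * ?B + 16.32 * (H1 / m))"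
      by (rule add_mono[OF add_mono[OF order_refl mult_left_mono[OF D]] coarse[OF B0]]) simp
    also have "\<dots> = 1.86 * (4 * (H0 / m) + 4 * (H1 / m)) + 8.1 * (10 / 3 * (H1 / m) + H2 / m + 4 / 3 * (H0 / m))
          + (2.04 * (4 * (H0 / m) + 4 * (H1 / m)) + 16.32 * (H1 / m))"
      by (simp only: add_divide_distrib distrib_left)
    \<comment> \<open>The target coefficients are \<open>24 * 3\<close>, \<open>24 * 23\<close> and
      \<open>24 * 42\<close>.\<close>
    also have "1.86 * (4 * (H0 / m) + 4 * (H1 / m)) + 8.1 * (10 / 3 * (H1 / m) + H2 / m + 4 / 3 * (H0 / m))
          + (2.04 * (4 * (H0 / m) + 4 * (H1 / m)) + 16.32 * (H1 / m))
        \<le> 72 * (H0 / m) + 552 * (H1 / m) + 1008 * (H2 / m)"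
    proof -
      have "0 \<le> H0 / m" "0 \<le> H1 / m" "0 \<le> H2 / m" using H H0' m(1) by auto
      moreover have "1.86 * (4 * a + 4 * b) + 8.1 * (10 / 3 * b + c + 4 / 3 * a) + (2.04 * (4 * a + 4 * b) + 16.32 * b)
          \<le> 72 * a + 552 * b + 1008 * c" if "0 \<le> a" "0 \<le> b" "0 \<le> c" for a b c :: real
        using that by (simp add: field_simps)
      ultimately show ?thesis by blast
    qed
    also have "\<dots> = 24 / m * (3 * H0 + 23 * H1 + 42 * H2)"
      by (simp add: algebra_simps)
    finally have "(1.86 * ?B + 8.1 * ((2 * H1 + H2 + ?B) / (m + 2)) + 2.72 / real r * (m / 2 * ?B + 4 * H1)) * S
        \<le> 24 / m * (3 * H0 + 23 * H1 + 42 * H2) * S"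
      using S by (rule mult_right_mono)
    moreover have "\<bar>g1 x\<bar> \<le> ?B" if "0 \<le> x" for x
      using bounded[OF H0 that] by simp
    ultimately show ?thesis
      using main[of ?B] by (simp add: m_def)
  qed
qed

lemma power_divergence_pearson_lipschitz_le:
  assumes n: "0 < n" and l: "-1 < l" and np: "\<And>j. j \<in> {1..r} \<Longrightarrow> 2 \<le> real n * p j"
    and np_l: "\<And>j. j \<in> {1..r} \<Longrightarrow> 2 \<le> l \<Longrightarrow> 2 * (l - 2)\<^sup>2 \<le> real n * p j"
    and lip: "\<And>x y. 0 \<le> x \<Longrightarrow> 0 \<le> y \<Longrightarrow> \<bar>h x - h y\<bar> \<le> H * \<bar>x - y\<bar>" and H: "0 \<le> H"
  shows "\<bar>E n (\<lambda>u. h (power_divergence l n r p u)) - E n (\<lambda>u. h (pearson n n u))\<bar>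
    \<le> \<bar>l - 1\<bar> * (4 * l + 7) / (l + 1) * H * (\<Sum>j=1..r. 1 / sqrt (real n * p j))"
proof -
  have "\<bar>E n (\<lambda>u. h (power_divergence l n r p u)) - E n (\<lambda>u. h (pearson n n u))\<bar>
      \<le> E n (\<lambda>u. \<bar>h (power_divergence l n r p u) - h (pearson n n u)\<bar>)"
    unfolding E_diff[symmetric] by (rule abs_E_le)
  also have "\<dots> \<le> E n (\<lambda>u. H * \<bar>power_divergence l n r p u - pearson n n u\<bar>)"
    by (intro E_mono lip power_divergence_nonneg pearson_nonneg n l)
  also have "\<dots> \<le> H * (\<bar>l - 1\<bar> * (4 * l + 7) / (l + 1) * (\<Sum>j=1..r. 1 / sqrt (real n * p j)))"
    unfolding E_cmult by (intro mult_left_mono E_power_divergence_minus_pearson_le l np np_l H)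
  finally show ?thesis by (simp add: mult_ac)
qed

end

lemma Cb_from_to_has_derivative:
  assumes "h \<in> Cb_from_to j k" "i < k" "0 \<le> x"
  shows "(halfline_deriv i h has_real_derivative halfline_deriv (Suc i) h x) (at x within {0..})"
proof -
  have "halfline_deriv i h differentiable (at x within {0..})"
    using assms by (auto simp: Cb_from_to_def differentiable_on_def)
  then show ?thesis
    by (simp add: vector_derivative_works has_real_derivative_iff_has_vector_derivative halfline_deriv_def)
qed

lemma Cb_from_to_le_norm:
  assumes "h \<in> Cb_from_to j k" "i \<in> {j..k}" "0 \<le> x"
  shows "\<bar>halfline_deriv i h x\<bar> \<le> halfline_norm (halfline_deriv i h)"
proof -
  have "bounded (halfline_deriv i h ` {0..})"
    using assms by (auto simp: Cb_from_to_def)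
  then have "bdd_above ((\<lambda>x. \<bar>halfline_deriv i h x\<bar>) ` {0..})"
    by (auto simp: bounded_iff bdd_above_def)
  then show ?thesis
    unfolding halfline_norm_def using assms(3) by (intro cSUP_upper) auto
qed

theorem theorem2p3:
  fixes n r :: nat
    and p :: "nat \<Rightarrow> real"
    and l :: real
    and M :: "'a measure"
    and X :: "nat \<Rightarrow> 'a \<Rightarrow> nat"
  assumes "n \<ge> 1" and "r \<ge> 2"
    and "\<And>j. j \<in> {1..r} \<Longrightarrow> p j > 0"
    and "(\<Sum>j=1..r. p j) = 1"
    and "prob_space M"
    and "prob_space.indep_vars M (\<lambda>_. count_space {1..r}) X {1..n}"
    and "\<And>i j. i \<in> {1..n} \<Longrightarrow> j \<in> {1..r} \<Longrightarrow> measure M {\<omega> \<in> space M. X i \<omega> = j} = p j"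
    and "l > -1"
    and "real n * Min (p ` {1..r}) \<ge> 2"
    and "l \<ge> 2 \<Longrightarrow> real n * Min (p ` {1..r}) \<ge> 2 * (l - 2)^2"
  shows
    "(\<forall>h \<in> Cb 2.
        \<bar>(LINT \<omega>|M. h (power_divergence l n r p (class_count n X \<omega>))) - chi_square_expectation (r - 1) h\<bar>
        \<le> (24 / (real r + 1) *
              (3 * halfline_norm h + 23 * halfline_norm (halfline_deriv 1 h)
                 + 42 * halfline_norm (halfline_deriv 2 h))
            + \<bar>l - 1\<bar> * (4 * l + 7) / (l + 1) * halfline_norm (halfline_deriv 1 h))
          * (\<Sum>j=1..r. 1 / sqrt (real n * p j)))
   \<and> (\<forall>h \<in> Cb_from_to 1 2.
        \<bar>(LINT \<omega>|M. h (power_divergence l n r p (class_count n X \<omega>))) - chi_square_expectation (r - 1) h\<bar>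
        \<le> (1 / sqrt (real r + 1) *
              (115 * halfline_norm (halfline_deriv 1 h) + 536 * halfline_norm (halfline_deriv 2 h))
            + \<bar>l - 1\<bar> * (4 * l + 7) / (l + 1) * halfline_norm (halfline_deriv 1 h))
          * (\<Sum>j=1..r. 1 / sqrt (real n * p j)))"
proof -
  interpret class_probabilities r p
    using assms(3,4) by unfold_locales
  let ?S = "\<Sum>j=1..r. 1 / sqrt (real n * p j)"
  let ?C = "\<bar>l - 1\<bar> * (4 * l + 7) / (l + 1)"
  have min: "real n * Min (p ` {1..r}) \<le> real n * p j" if "j \<in> {1..r}" for j
    using that by (intro mult_left_mono Min_le) auto
  have np: "2 \<le> real n * p j" if "j \<in> {1..r}" for j
    using min[OF that] assms(9) by linarith
  have np_l: "2 * (l - 2)\<^sup>2 \<le> real n * p j" if "j \<in> {1..r}" "2 \<le> l" for j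
    using min[OF that(1)] assms(10)[OF that(2)] by linarith
  have expect: "(LINT \<omega>|M. \<phi> (class_count n X \<omega>)) = E n \<phi>" for \<phi>
    by (rule prob_space.expectation_class_count[OF assms(5-7)])
  \<comment> \<open>Both parts share the derivative bounds of \<open>Cb_from_to 1 2\<close>; only
    part (a) has a bound on \<open>h\<close> itself, which enters through the parameter
    \<open>H0\<close>.\<close>
  have bounds: "\<bar>(LINT \<omega>|M. h (power_divergence l n r p (class_count n X \<omega>))) - chi_square_expectation (r - 1) h\<bar>
        \<le> (1 / sqrt (real r + 1) * (115 * halfline_norm (halfline_deriv 1 h) + 536 * halfline_norm (halfline_deriv 2 h))
            + ?C * halfline_norm (halfline_deriv 1 h)) * ?S"
      "(\<And>x. 0 \<le> x \<Longrightarrow> \<bar>h x\<bar> \<le> H0) \<Longrightarrow>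
        \<bar>(LINT \<omega>|M. h (power_divergence l n r p (class_count n X \<omega>))) - chi_square_expectation (r - 1) h\<bar>
        \<le> (24 / (real r + 1) * (3 * H0 + 23 * halfline_norm (halfline_deriv 1 h) + 42 * halfline_norm (halfline_deriv 2 h))
            + ?C * halfline_norm (halfline_deriv 1 h)) * ?S"
    if h: "h \<in> Cb_from_to 1 2" for h H0
  proof -
    let ?H1 = "halfline_norm (halfline_deriv 1 h)"
    have d1: "(h has_real_derivative halfline_deriv 1 h x) (at x within {0..})" if "0 \<le> x" for x
      using Cb_from_to_has_derivative[OF h, of 0 x] that by (simp add: halfline_deriv_def)
    have d2: "(halfline_deriv 1 h has_real_derivative halfline_deriv 2 h x) (at x within {0..})" if "0 \<le> x" for x
      using Cb_from_to_has_derivative[OF h, of 1 x] that by (simp add: numeral_2_eq_2)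
    have b1: "\<bar>halfline_deriv 1 h x\<bar> \<le> ?H1" and b2: "\<bar>halfline_deriv 2 h x\<bar> \<le> halfline_norm (halfline_deriv 2 h)"
      if "0 \<le> x" for x
      using Cb_from_to_le_norm[OF h _ that] by auto
    have lip: "\<bar>h x - h y\<bar> \<le> ?H1 * \<bar>x - y\<bar>" if "0 \<le> x" "0 \<le> y" for x y
      using field_differentiable_bound[of "{0..}" h "halfline_deriv 1 h" ?H1 x y] d1 b1 that by simp
    have "0 \<le> ?H1" using b1[of 0] by simp
    note diff = power_divergence_pearson_lipschitz_le[OF _ assms(8) np np_l lip this]
    \<comment> \<open>Triangle inequality with the Pearson expectation as intermediate value
      \<open>y\<close>.\<close>
    have comb: "\<bar>x - c\<bar> \<le> (a + b) * s" if "\<bar>x - y\<bar> \<le> b * s" "\<bar>y - c\<bar> \<le> a * s" for a b c s x y :: real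
      using that by (simp add: distrib_right)
    show "\<bar>(LINT \<omega>|M. h (power_divergence l n r p (class_count n X \<omega>))) - chi_square_expectation (r - 1) h\<bar>
        \<le> (1 / sqrt (real r + 1) * (115 * ?H1 + 536 * halfline_norm (halfline_deriv 2 h)) + ?C * ?H1) * ?S"
      unfolding expect[of "\<lambda>u. h (power_divergence l n r p u)"]
      by (rule comb[OF diff pearson_chi_square_bounds(1)[OF assms(2) np d1 d2 b1 b2]]) (use assms(1) in auto)
    show "\<bar>(LINT \<omega>|M. h (power_divergence l n r p (class_count n X \<omega>))) - chi_square_expectation (r - 1) h\<bar>
        \<le> (24 / (real r + 1) * (3 * H0 + 23 * ?H1 + 42 * halfline_norm (halfline_deriv 2 h)) + ?C * ?H1) * ?S"
      if "\<And>x. 0 \<le> x \<Longrightarrow> \<bar>h x\<bar> \<le> H0"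
      unfolding expect[of "\<lambda>u. h (power_divergence l n r p u)"]
      by (rule comb[OF diff pearson_chi_square_bounds(2)[OF assms(2) np d1 d2 b1 b2 that]]) (use assms(1) in auto)
  qed
  show ?thesis
  proof (intro conjI ballI)
    fix h assume h: "h \<in> Cb 2"
    then have "h \<in> Cb_from_to 1 2" by (auto simp: Cb_def Cb_from_to_def)
    moreover have "\<bar>h x\<bar> \<le> halfline_norm h" if "0 \<le> x" for x
      using Cb_from_to_le_norm[of h 0 2 0 x] h that by (simp add: Cb_def halfline_deriv_def)
    ultimately show "\<bar>(LINT \<omega>|M. h (power_divergence l n r p (class_count n X \<omega>))) - chi_square_expectation (r - 1) h\<bar>
        \<le> (24 / (real r + 1) * (3 * halfline_norm h + 23 * halfline_norm (halfline_deriv 1 h) + 42 * halfline_norm (halfline_deriv 2 h))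
            + ?C * halfline_norm (halfline_deriv 1 h)) * ?S"
      by (rule bounds(2))
  next
    fix h assume "h \<in> Cb_from_to 1 2"
    then show "\<bar>(LINT \<omega>|M. h (power_divergence l n r p (class_count n X \<omega>))) - chi_square_expectation (r - 1) h\<bar>
        \<le> (1 / sqrt (real r + 1) * (115 * halfline_norm (halfline_deriv 1 h) + 536 * halfline_norm (halfline_deriv 2 h))
            + ?C * halfline_norm (halfline_deriv 1 h)) * ?S"
      by (rule bounds(1))
  qed
qed

end
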